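(* Assume the Setting (S) described in the context. Then for every integer $n\ge 0$, $$\frac{1}{2\pi}\int_D \Omega_n\,dx\,dy=\mathcal C,\qquad \frac{1}{2\pi}\int_D \operatorname{Tr} g_n\,dx\,dy=(2n+1)\,\frac{1}{2\pi}\int_D \Omega_n\,dx\,dy=(2n+1)\,\mathcal C .$$
   Context: Setting (S). Let $\mathcal H$ be a separable complex Hilbert space with inner product $\langle\cdot|\cdot\rangle$, antilinear in the first slot. Let $\Lambda\subset\mathbb C$ be a lattice with fundamental domain $D$. Write $z=x+iy$, $\partial=\tfrac12(\partial_x-i\partial_y)$, $\bar\partial=\tfrac12(\partial_x+i\partial_y)$. Let $f:\mathbb C\to\mathcal H$ be holomorphic and satisfy: (i) for every $z\in\mathbb C$ and every $n\ge0$ the vectors $f(z),\partial f(z),\dots,\partial^n f(z)$ are linearly independent; (ii) for every $\lambda\in\Lambda$ there are a nowhere-vanishing holomorphic function $c_\lambda:\mathbb C\to\mathbb C$ and a unitary operator $V_\lambda$ on $\mathcal H$ independent of $z$ such that $f(z+\lambda)=c_\lambda(z)V_\lambda f(z)$ for all $z$. For $n\ge0$ let $P_n(z)$ be the orthogonal projector onto $\mathrm{span}\{f(z),\partial f(z),\dots,\partial^{n-1}f(z)\}$ (with $P_0=0$), let $r_n=\|(1-P_n)\partial^n f\|>0$ and define the "generalized Landau levels" $u_n=(1-P_n)\partial^n f/r_n$ (so $(u_n)_{n\ge0}$ is the Gram–Schmidt orthonormalization of $f,\partial f,\partial^2 f,\dots$; $u_0=f/\|f\|$). For a smooth unit-vector-valued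 map $u$ of $(x,y)$ define the quantum geometric tensor $\chi_{ab}=\langle\partial_a u|(1-|u\rangle\langle u|)|\partial_b u\rangle$ for $a,b\in\{x,y\}$, the quantum metric $g_{ab}=\operatorname{Re}\chi_{ab}$, its trace $\operatorname{Tr} g=g_{xx}+g_{yy}$, and the Berry curvature $\Omega=2\operatorname{Im}\chi_{xy}$. Write $g_n,\Omega_n$ for these quantities computed from $u=u_n$ (they are $\Lambda$-periodic functions). The Chern number is $\mathcal C=\frac1{2\pi}\int_D\Omega_0\,dx\,dy$. *)

theory Defs
  imports "HOL-Analysis.Analysis"
begin

class cvec = real_vector +
  fixes scaleC :: "complex \<Rightarrow> 'a \<Rightarrow> 'a" (infixr "*\<^sub>C" 75)
  assumes scaleC_add_right: "a *\<^sub>C (x + y) = a *\<^sub>C x + a *\<^sub>C y"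
    and scaleC_add_left: "(a + b) *\<^sub>C x = a *\<^sub>C x + b *\<^sub>C x"
    and scaleC_scaleC: "a *\<^sub>C (b *\<^sub>C x) = (a * b) *\<^sub>C x"
    and scaleC_one: "1 *\<^sub>C x = x"
    and scaleR_scaleC: "scaleR r x = complex_of_real r *\<^sub>C x"

class cinner_space = cvec + real_normed_vector +
  fixes cinner :: "'a \<Rightarrow> 'a \<Rightarrow> complex"
  assumes cinner_cnj_commute: "cinner x y = cnj (cinner y x)"
    and cinner_add_right: "cinner x (y + z) = cinner x y + cinner x z"
    and cinner_scaleC_right: "cinner x (a *\<^sub>C y) = a * cinner x y"
    and cinner_nonneg: "0 \<le> Re (cinner x x)"
    and cinner_eq_zero_iff: "cinner x x = 0 \<longleftrightarrow> x = 0"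
    and norm_eq_sqrt_cinner: "norm x = sqrt (Re (cinner x x))"

class chilbert = cinner_space + complete_space

definition cspan :: "'a::cvec set \<Rightarrow> 'a set" where
  "cspan S = {x. \<exists>F c. finite F \<and> F \<subseteq> S \<and> x = (\<Sum>a\<in>F. c a *\<^sub>C a)}"

definition orth_proj :: "'a::cinner_space set \<Rightarrow> 'a \<Rightarrow> 'a" where
  "orth_proj M x = (THE m. m \<in> M \<and> (\<forall>w\<in>M. cinner w (x - m) = 0))"

definition unitary_op :: "('a::cinner_space \<Rightarrow> 'a) \<Rightarrow> bool" where
  "unitary_op V \<longleftrightarrow> (\<forall>a x y. V (a *\<^sub>C x + y) = a *\<^sub>C V x + V y)
      \<and> (\<forall>x y. cinner (V x) (V y) = cinner x y) \<and> surj V"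

definition has_cderiv :: "(complex \<Rightarrow> 'a::cinner_space) \<Rightarrow> 'a \<Rightarrow> complex \<Rightarrow> bool" where
  "has_cderiv f v z \<longleftrightarrow> (f has_derivative (\<lambda>h. h *\<^sub>C v)) (at z)"

definition cholomorphic :: "(complex \<Rightarrow> 'a::cinner_space) \<Rightarrow> bool" where
  "cholomorphic f \<longleftrightarrow> (\<forall>z. \<exists>v. has_cderiv f v z)"

definition cderiv :: "(complex \<Rightarrow> 'a::cinner_space) \<Rightarrow> complex \<Rightarrow> 'a" where
  "cderiv f = (\<lambda>z. SOME v. has_cderiv f v z)"

definition cderivs :: "nat \<Rightarrow> (complex \<Rightarrow> 'a::cinner_space) \<Rightarrow> complex \<Rightarrow> 'a" where
  "cderivs n f = (cderiv ^^ n) f"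

definition derivs_indep :: "(complex \<Rightarrow> 'a::cinner_space) \<Rightarrow> complex \<Rightarrow> nat \<Rightarrow> bool" where
  "derivs_indep f z n \<longleftrightarrow>
     (\<forall>c::nat \<Rightarrow> complex. (\<Sum>k\<le>n. c k *\<^sub>C cderivs k f z) = 0 \<longrightarrow> (\<forall>k\<le>n. c k = 0))"

definition Pn :: "(complex \<Rightarrow> 'a::cinner_space) \<Rightarrow> nat \<Rightarrow> complex \<Rightarrow> 'a \<Rightarrow> 'a" where
  "Pn f n z = orth_proj (cspan ((\<lambda>k. cderivs k f z) ` {..<n}))"

definition rn :: "(complex \<Rightarrow> 'a::cinner_space) \<Rightarrow> nat \<Rightarrow> complex \<Rightarrow> real" where
  "rn f n z = norm (cderivs n f z - Pn f n z (cderivs n f z))"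

definition landau :: "(complex \<Rightarrow> 'a::cinner_space) \<Rightarrow> nat \<Rightarrow> complex \<Rightarrow> 'a" where
  "landau f n z = complex_of_real (inverse (rn f n z)) *\<^sub>C
                    (cderivs n f z - Pn f n z (cderivs n f z))"

text \<open>Real partial derivative of u in direction e (e = 1: \<partial>_x, e = i: \<partial>_y).\<close>
definition pdir :: "(complex \<Rightarrow> 'a::cinner_space) \<Rightarrow> complex \<Rightarrow> complex \<Rightarrow> 'a" where
  "pdir u e z = vector_derivative (\<lambda>t::real. u (z + complex_of_real t * e)) (at 0)"

definition qgt :: "(complex \<Rightarrow> 'a::cinner_space) \<Rightarrow> complex \<Rightarrow> complex \<Rightarrow> complex \<Rightarrow> complex" where
  "qgt u a b z = cinner (pdir u a z) (pdir u b z)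
                 - cinner (pdir u a z) (u z) * cinner (u z) (pdir u b z)"

definition trace_metric :: "(complex \<Rightarrow> 'a::cinner_space) \<Rightarrow> complex \<Rightarrow> real" where
  "trace_metric u z = Re (qgt u 1 1 z) + Re (qgt u \<i> \<i> z)"

definition berry :: "(complex \<Rightarrow> 'a::cinner_space) \<Rightarrow> complex \<Rightarrow> real" where
  "berry u z = 2 * Im (qgt u 1 \<i> z)"

definition lattice :: "complex \<Rightarrow> complex \<Rightarrow> complex set" where
  "lattice w1 w2 = {of_int m * w1 + of_int n * w2 | m n. True}"

definition fundamental_domain :: "complex set \<Rightarrow> complex set \<Rightarrow> bool" where
  "fundamental_domain L D \<longleftrightarrow> D \<in> sets lebesgue \<and> (\<forall>z. \<exists>!l. l \<in> L \<and> z + l \<in> D)"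

definition chern :: "(complex \<Rightarrow> 'a::cinner_space) \<Rightarrow> complex set \<Rightarrow> real" where
  "chern f D = integral D (berry (landau f 0)) / (2 * pi)"

end

theory Submission
  imports Defs "HOL-Complex_Analysis.Complex_Analysis"
begin

text \<open>
  Let \<open>v\<^sub>n\<close> be the unnormalised Gram--Schmidt vectors of \<open>f, \<partial>f, \<partial>\<^sup>2f, \<dots>\<close> and
  \<open>\<rho>\<^sub>n = |v\<^sub>n|\<^sup>2 / |v\<^sub>n\<^sub>-\<^sub>1|\<^sup>2\<close> (with \<open>\<rho>\<^sub>0 = 0\<close>). Holomorphy of \<open>f\<close> gives the ladder relations
  \<open>\<partial>v\<^sub>n = v\<^sub>n\<^sub>+\<^sub>1 + \<alpha>\<^sub>n v\<^sub>n\<close> and \<open>dbar v\<^sub>n = - \<rho>\<^sub>n v\<^sub>n\<^sub>-\<^sub>1\<close>, from which the Berry curvature is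
  \<open>2 (\<rho>\<^sub>n\<^sub>+\<^sub>1 - \<rho>\<^sub>n)\<close> and the trace of the metric is \<open>2 (\<rho>\<^sub>n\<^sub>+\<^sub>1 + \<rho>\<^sub>n)\<close>. It remains to see that
  \<open>\<integral>\<rho>\<^sub>n = n \<integral>\<rho>\<^sub>1\<close> over a fundamental domain. The function
  \<open>b\<^sub>n = \<langle>v\<^sub>n, \<partial>\<^sup>n\<^sup>+\<^sup>1 f\<rangle> / |v\<^sub>n|\<^sup>2\<close> satisfies \<open>dbar b\<^sub>n = \<rho>\<^sub>n\<^sub>+\<^sub>1\<close> and, under a lattice translation with
  multiplier \<open>c\<close>, changes by \<open>(n + 1) c' / c\<close>. Hence \<open>b\<^sub>n - (n + 1) b\<^sub>0\<close> is periodic, and the integral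
  of its dbar-derivative vanishes: the integral of a periodic function is invariant under translating
  the function, so the derivative along the translation integrates to zero.
\<close>

section \<open>Complex inner product spaces\<close>

text \<open>Scalar functions become a special case of the Wirtinger calculus for vector-valued ones.\<close>

instantiation complex :: chilbert
begin
definition scaleC_complex_def: "scaleC = ((*) :: complex \<Rightarrow> complex \<Rightarrow> complex)"
definition cinner_complex_def: "cinner x y = cnj x * (y :: complex)"
instance
  by standard (auto simp: scaleC_complex_def cinner_complex_def algebra_simps scaleR_conv_of_real
      cmod_power2 norm_complex_def power2_eq_square)
end

global_interpretation cv: vector_space "scaleC :: complex \<Rightarrow> 'a \<Rightarrow> 'a::cvec"
  by standard (simp_all add: scaleC_add_right scaleC_add_left scaleC_scaleC scaleC_one)

lemma cspan_eq_span: "cspan S = cv.span S"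
  unfolding cspan_def cv.span_explicit by blast

lemma cinner_zero_right [simp]: "cinner x 0 = 0"
  using cinner_add_right[of x 0 0] by simp

lemma cinner_minus_right: "cinner x (- y) = - cinner x y"
  using cinner_add_right[of x y "- y"] by (simp add: eq_neg_iff_add_eq_0 add.commute)

lemma cinner_diff_right: "cinner x (y - z) = cinner x y - cinner x z"
  using cinner_add_right[of x y "- z"] by (simp add: cinner_minus_right)

lemma cinner_zero_left [simp]: "cinner 0 x = 0"
  by (subst cinner_cnj_commute) simp

lemma cinner_add_left: "cinner (x + y) z = cinner x z + cinner y z"
  by (metis cinner_add_right cinner_cnj_commute complex_cnj_add)

lemma cinner_diff_left: "cinner (x - y) z = cinner x z - cinner y z"
  by (metis cinner_diff_right cinner_cnj_commute complex_cnj_diff)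

lemma cinner_scaleC_left: "cinner (a *\<^sub>C x) y = cnj a * cinner x y"
  by (metis cinner_scaleC_right cinner_cnj_commute complex_cnj_mult)

lemma cinner_sum_right: "cinner x (\<Sum>k\<in>I. g k) = (\<Sum>k\<in>I. cinner x (g k))"
  by (induction I rule: infinite_finite_induct) (simp_all add: cinner_add_right)

lemma cinner_commute_zero: "cinner x y = 0 \<longleftrightarrow> cinner y x = 0"
  by (metis cinner_cnj_commute complex_cnj_zero)

lemma cinner_self: "cinner x x = complex_of_real ((norm x)\<^sup>2)"
proof -
  have "Im (cinner x x) = 0"
    using arg_cong[OF cinner_cnj_commute[of x x], of Im] by simp
  then show ?thesis
    by (simp add: complex_eq_iff norm_eq_sqrt_cinner cinner_nonneg)
qed

lemma norm_scaleC: "norm (a *\<^sub>C x) = cmod a * norm (x::'a::cinner_space)"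
proof -
  have "complex_of_real ((norm (a *\<^sub>C x))\<^sup>2) = complex_of_real ((cmod a * norm x)\<^sup>2)"
    unfolding cinner_self[symmetric] cinner_scaleC_left cinner_scaleC_right
    by (simp add: cinner_self power_mult_distrib) (metis complex_norm_square of_real_power)
  then have "(norm (a *\<^sub>C x))\<^sup>2 = (cmod a * norm x)\<^sup>2"
    by (simp only: of_real_eq_iff)
  then show ?thesis
    by (simp add: power2_eq_iff_nonneg)
qed

text \<open>Subtracting from \<open>y\<close> its projection onto the line through \<open>x\<close>
  leaves a vector whose squared norm is nonnegative; expanding that norm gives the bound.\<close>

lemma cinner_Cauchy_Schwarz: "cmod (cinner x y) \<le> norm x * norm y"
proof (cases "x = 0")
  case False
  define c where "c = cinner x y / cinner x x"
  have x: "cinner x x \<noteq> 0"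
    using False by (simp add: cinner_eq_zero_iff)
  have xc: "cnj (cinner x x) = cinner x x"
    by (metis cinner_cnj_commute)
  have yx: "cinner y x = cnj (cinner x y)"
    by (rule cinner_cnj_commute)
  have "cinner (y - c *\<^sub>C x) (y - c *\<^sub>C x) = cinner y y - cnj (cinner x y) * cinner x y / cinner x x"
    using x by (simp add: cinner_diff_left cinner_diff_right cinner_scaleC_left cinner_scaleC_right
        c_def xc yx field_simps)
  also have "cnj (cinner x y) * cinner x y = of_real ((cmod (cinner x y))\<^sup>2)"
    by (simp only: complex_norm_square mult.commute)
  finally have "of_real ((norm (y - c *\<^sub>C x))\<^sup>2)
      = complex_of_real ((norm y)\<^sup>2 - (cmod (cinner x y))\<^sup>2 / (norm x)\<^sup>2)"
    by (simp add: cinner_self)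
  then have "(norm (y - c *\<^sub>C x))\<^sup>2 = (norm y)\<^sup>2 - (cmod (cinner x y))\<^sup>2 / (norm x)\<^sup>2"
    by (simp only: of_real_eq_iff)
  then have "(cmod (cinner x y))\<^sup>2 / (norm x)\<^sup>2 \<le> (norm y)\<^sup>2"
    by (metis diff_ge_0_iff_ge zero_le_power2)
  then have "(cmod (cinner x y))\<^sup>2 \<le> (norm x * norm y)\<^sup>2"
    using False by (simp add: field_simps)
  then show ?thesis
    by (rule power2_le_imp_le) simp
qed simp

lemma bounded_bilinear_scaleC:
  "bounded_bilinear (scaleC :: complex \<Rightarrow> 'a \<Rightarrow> 'a::cinner_space)"
  by (standard; (rule exI[of _ 1])?)
    (simp_all add: scaleC_add_right scaleC_add_left scaleR_scaleC scaleC_scaleC norm_scaleC scaleC_complex_def mult.commute)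

lemma bounded_bilinear_cinner:
  "bounded_bilinear (cinner :: 'a \<Rightarrow> 'a::cinner_space \<Rightarrow> complex)"
  by (standard; (rule exI[of _ 1])?)
    (simp_all add: cinner_add_right cinner_add_left scaleR_scaleC cinner_scaleC_left cinner_scaleC_right
      cinner_Cauchy_Schwarz scaleC_complex_def)

lemmas continuous_on_scaleC [continuous_intros] = bounded_bilinear.continuous_on[OF bounded_bilinear_scaleC]
lemmas continuous_on_cinner [continuous_intros] = bounded_bilinear.continuous_on[OF bounded_bilinear_cinner]

text \<open>Take \<open>w = x\<close>. This turns scalar estimates that are uniform in the test
  vector into norm estimates.\<close>

lemma norm_le_if_cinner_le:
  assumes "\<And>w. cmod (cinner w x) \<le> K * norm w" "0 \<le> K"
  shows "norm x \<le> K"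
proof (cases "x = 0")
  case False
  then show ?thesis
    using assms(1)[of x] by (simp add: cinner_self power2_eq_square norm_mult)
qed (simp add: assms(2))


section \<open>Wirtinger derivatives\<close>

text \<open>The values of the derivative at 1 and at \<open>\<i>\<close> determine
  \<open>p + q\<close> and \<open>p - q\<close>.\<close>

lemma has_derivative_at_Wirtinger_unique:
  fixes p :: "'a::cinner_space"
  assumes "(u has_derivative (\<lambda>h. h *\<^sub>C p + cnj h *\<^sub>C q)) (at z)"
    and "(u has_derivative (\<lambda>h. h *\<^sub>C p' + cnj h *\<^sub>C q')) (at z)"
  shows "p = p' \<and> q = q'"
proof -
  have eq: "h *\<^sub>C p + cnj h *\<^sub>C q = h *\<^sub>C p' + cnj h *\<^sub>C q'" for h
    using has_derivative_unique[OF assms] by (rule fun_cong)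
  have 1: "p + q = p' + q'"
    using eq[of 1] by simp
  have "\<i> *\<^sub>C (p - q) = \<i> *\<^sub>C (p' - q')"
    using eq[of \<i>] by (simp add: cv.scale_right_diff_distrib)
  then have 2: "p - q = p' - q'"
    by (simp add: cv.scale_left_imp_eq)
  have "2 *\<^sub>R p = 2 *\<^sub>R p'"
    using arg_cong2[OF 1 2, of "(+)"] by (simp add: scaleR_2)
  then show ?thesis
    using 1 by simp
qed

text \<open>Here \<open>p\<close> is the derivative of \<open>u\<close> with respect to z and
  \<open>q\<close> its dbar-derivative. Their continuity is bundled in, so that the calculus rules
  preserve it and the derivatives can later be bounded and integrated.\<close>

definition has_wirtinger ::
    "(complex \<Rightarrow> 'a::cinner_space) \<Rightarrow> (complex \<Rightarrow> 'a) \<Rightarrow> (complex \<Rightarrow> 'a) \<Rightarrow> bool" where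
  "has_wirtinger u p q \<longleftrightarrow>
     (\<forall>z. (u has_derivative (\<lambda>h. h *\<^sub>C p z + cnj h *\<^sub>C q z)) (at z))
     \<and> continuous_on UNIV p \<and> continuous_on UNIV q"

lemma has_wirtinger_continuous: "has_wirtinger u p q \<Longrightarrow> continuous_on UNIV u"
  unfolding has_wirtinger_def
  by (meson continuous_at_imp_continuous_on has_derivative_continuous)

lemma has_wirtinger_unique:
  "has_wirtinger u p q \<Longrightarrow> has_wirtinger u p' q' \<Longrightarrow> p = p' \<and> q = q'"
  unfolding has_wirtinger_def fun_eq_iff
  using has_derivative_at_Wirtinger_unique by blast

lemma has_wirtinger_const: "has_wirtinger (\<lambda>z. c) (\<lambda>z. 0) (\<lambda>z. 0)"
  by (simp add: has_wirtinger_def)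

lemma has_wirtinger_add:
  assumes "has_wirtinger u p q" "has_wirtinger v r s"
  shows "has_wirtinger (\<lambda>z. u z + v z) (\<lambda>z. p z + r z) (\<lambda>z. q z + s z)"
  using assms unfolding has_wirtinger_def
  by (auto intro!: derivative_eq_intros continuous_intros simp: scaleC_add_right)

lemma has_wirtinger_diff:
  assumes "has_wirtinger u p q" "has_wirtinger v r s"
  shows "has_wirtinger (\<lambda>z. u z - v z) (\<lambda>z. p z - r z) (\<lambda>z. q z - s z)"
  using assms unfolding has_wirtinger_def
  by (auto intro!: derivative_eq_intros continuous_intros simp: cv.scale_right_diff_distrib)

lemma has_wirtinger_sum:
  assumes "\<And>k. k \<in> I \<Longrightarrow> has_wirtinger (u k) (p k) (q k)"
  shows "has_wirtinger (\<lambda>z. \<Sum>k\<in>I. u k z) (\<lambda>z. \<Sum>k\<in>I. p k z) (\<lambda>z. \<Sum>k\<in>I. q k z)"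
  using assms
  by (induction I rule: infinite_finite_induct) (simp_all add: has_wirtinger_const has_wirtinger_add)

lemma has_wirtinger_scaleC:
  assumes "has_wirtinger u p q" "has_wirtinger v r s"
  shows "has_wirtinger (\<lambda>z. u z *\<^sub>C v z)
    (\<lambda>z. p z *\<^sub>C v z + u z *\<^sub>C r z) (\<lambda>z. q z *\<^sub>C v z + u z *\<^sub>C s z)"
proof -
  note C = has_wirtinger_continuous[OF assms(1)] has_wirtinger_continuous[OF assms(2)]
  have "((\<lambda>z. u z *\<^sub>C v z) has_derivative
      (\<lambda>h. h *\<^sub>C (p z *\<^sub>C v z + u z *\<^sub>C r z) + cnj h *\<^sub>C (q z *\<^sub>C v z + u z *\<^sub>C s z))) (at z)" for z
    using assms unfolding has_wirtinger_def
    by (auto intro!: has_derivative_eq_rhs[OF bounded_bilinear.FDERIV[OF bounded_bilinear_scaleC]]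
        simp: fun_eq_iff scaleC_add_right scaleC_add_left scaleC_complex_def algebra_simps)
  then show ?thesis
    using assms C unfolding has_wirtinger_def by (auto intro!: continuous_intros)
qed

text \<open>The first slot is antilinear, so differentiating it in z uses the dbar-derivative
  \<open>q\<close> of \<open>u\<close>, and conversely.\<close>

lemma has_wirtinger_cinner:
  assumes "has_wirtinger u p q" "has_wirtinger v r s"
  shows "has_wirtinger (\<lambda>z. cinner (u z) (v z))
    (\<lambda>z. cinner (q z) (v z) + cinner (u z) (r z)) (\<lambda>z. cinner (p z) (v z) + cinner (u z) (s z))"
proof -
  note C = has_wirtinger_continuous[OF assms(1)] has_wirtinger_continuous[OF assms(2)]
  have "((\<lambda>z. cinner (u z) (v z)) has_derivative
      (\<lambda>h. h *\<^sub>C (cinner (q z) (v z) + cinner (u z) (r z)) + cnj h *\<^sub>C (cinner (p z) (v z) + cinner (u z) (s z)))) (at z)" for z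
    using assms unfolding has_wirtinger_def
    by (auto intro!: has_derivative_eq_rhs[OF bounded_bilinear.FDERIV[OF bounded_bilinear_cinner]]
        simp: fun_eq_iff cinner_add_right cinner_add_left cinner_scaleC_left cinner_scaleC_right
          scaleC_complex_def algebra_simps)
  then show ?thesis
    using assms C unfolding has_wirtinger_def by (auto intro!: continuous_intros)
qed

lemma has_wirtinger_inverse:
  fixes u :: "complex \<Rightarrow> complex"
  assumes "has_wirtinger u p q" "\<And>z. u z \<noteq> 0"
  shows "has_wirtinger (\<lambda>z. inverse (u z)) (\<lambda>z. - p z / (u z)\<^sup>2) (\<lambda>z. - q z / (u z)\<^sup>2)"
proof -
  note C = has_wirtinger_continuous[OF assms(1)]
  have "((\<lambda>z. inverse (u z)) has_derivative
      (\<lambda>h. h *\<^sub>C (- p z / (u z)\<^sup>2) + cnj h *\<^sub>C (- q z / (u z)\<^sup>2))) (at z)" for z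
    using assms unfolding has_wirtinger_def
    by (auto intro!: derivative_eq_intros
        simp: fun_eq_iff scaleC_complex_def power2_eq_square field_simps)
  then show ?thesis
    using assms C unfolding has_wirtinger_def by (auto intro!: continuous_intros)
qed

lemma has_wirtinger_divide:
  fixes u v :: "complex \<Rightarrow> complex"
  assumes "has_wirtinger u p q" "has_wirtinger v r s" "\<And>z. v z \<noteq> 0"
  shows "has_wirtinger (\<lambda>z. u z / v z)
    (\<lambda>z. (p z * v z - u z * r z) / (v z)\<^sup>2) (\<lambda>z. (q z * v z - u z * s z) / (v z)\<^sup>2)"
  using has_wirtinger_scaleC[OF assms(1) has_wirtinger_inverse[OF assms(2,3)]] assms(3)
  by (simp add: scaleC_complex_def field_simps power2_eq_square)

section \<open>Vector-valued holomorphic functions\<close>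

lemma has_cderiv_unique: "has_cderiv f v z \<Longrightarrow> has_cderiv f w z \<Longrightarrow> v = w"
  using has_derivative_at_Wirtinger_unique[of f v 0 z w 0] by (simp add: has_cderiv_def)

lemma has_cderiv_imp_cderiv_eq: "has_cderiv f v z \<Longrightarrow> cderiv f z = v"
  unfolding cderiv_def by (rule some_equality) (auto dest: has_cderiv_unique)

lemma cholomorphic_has_cderiv: "cholomorphic f \<Longrightarrow> has_cderiv f (cderiv f z) z"
  by (metis cholomorphic_def has_cderiv_imp_cderiv_eq)

lemma cholomorphic_continuous: "cholomorphic f \<Longrightarrow> continuous_on A f"
  unfolding cholomorphic_def has_cderiv_def
  by (meson continuous_at_imp_continuous_on has_derivative_continuous)

lemma cinner_has_field_derivative:
  assumes "has_cderiv f v z"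
  shows "((\<lambda>z. cinner w (f z)) has_field_derivative cinner w v) (at z)"
  unfolding has_field_derivative_def
  by (rule has_derivative_eq_rhs[OF bounded_linear.has_derivative[OF
          bounded_bilinear.bounded_linear_right[OF bounded_bilinear_cinner] assms[unfolded has_cderiv_def]]])
    (simp add: fun_eq_iff cinner_scaleC_right)

text \<open>First-order Taylor expansion of \<open>deriv \<phi>\<close>, whose remainder is
  controlled by the third derivative of \<open>\<phi>\<close>. Cauchy's inequality on unit circles
  around points of the unit ball bounds that by \<open>fact 3 * M = 6 * M\<close>. The constant
  depends on \<open>\<phi>\<close> only through \<open>M\<close>.\<close>

lemma entire_deriv_Taylor_bound:
  assumes hol: "\<phi> holomorphic_on UNIV" and M: "\<And>z. z \<in> cball z0 2 \<Longrightarrow> cmod (\<phi> z) \<le> M"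
    and h: "cmod h \<le> 1"
  shows "cmod (deriv \<phi> (z0 + h) - deriv \<phi> z0 - h * deriv (deriv \<phi>) z0) \<le> 6 * M * (cmod h)\<^sup>2"
proof -
  have hd: "(deriv ^^ i) \<phi> holomorphic_on UNIV" for i
    using hol by (rule holomorphic_higher_deriv) simp
  have B: "cmod ((deriv ^^ 3) \<phi> x) \<le> 6 * M" if "x \<in> cball z0 1" for x
  proof -
    have "cmod ((deriv ^^ 3) \<phi> x) \<le> fact 3 * M / 1 ^ 3"
    proof (rule Cauchy_inequality)
      show "\<phi> holomorphic_on ball x 1" "continuous_on (cball x 1) \<phi>"
        using hol holomorphic_on_imp_continuous_on holomorphic_on_subset subset_UNIV by metis+
      show "cmod (\<phi> y) \<le> M" if "cmod (x - y) = 1" for y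
      proof (rule M)
        have "dist z0 y \<le> dist z0 x + dist x y"
          by (rule dist_triangle)
        then show "y \<in> cball z0 2"
          using \<open>x \<in> cball z0 1\<close> that by (simp add: dist_norm)
      qed
    qed simp
    then show ?thesis
      by (simp add: fact_numeral)
  qed
  have "cmod ((deriv ^^ Suc 0) \<phi> (z0 + h) - (\<Sum>i\<le>1. (deriv ^^ Suc i) \<phi> z0 * (z0 + h - z0) ^ i / fact i))
      \<le> 6 * M * cmod (z0 + h - z0) ^ Suc 1 / fact 1"
  proof (rule complex_Taylor[where S = "cball z0 1" and f = "\<lambda>i. (deriv ^^ Suc i) \<phi>"])
    show "((deriv ^^ Suc i) \<phi> has_field_derivative (deriv ^^ Suc (Suc i)) \<phi> x) (at x within cball z0 1)" for i x
      using holomorphic_derivI[OF hd[of "Suc i"], of x] by (simp add: has_field_derivative_at_within)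
    show "cmod ((deriv ^^ Suc (Suc 1)) \<phi> x) \<le> 6 * M" if "x \<in> cball z0 1" for x
      using B[OF that] by (simp add: numeral_3_eq_3)
  qed (use h in \<open>auto simp: dist_norm\<close>)
  then show ?thesis
    by (simp add: algebra_simps power2_eq_square)
qed

text \<open>Iterating this makes all higher derivatives available. The difference quotients of
  \<open>cderiv f\<close> satisfy a Cauchy condition with an explicit linear rate, and completeness
  of the space supplies their limit.\<close>

lemma cholomorphic_cderiv:
  fixes f :: "complex \<Rightarrow> 'h::chilbert"
  assumes "cholomorphic f"
  shows "cholomorphic (cderiv f)"
  unfolding cholomorphic_def
proof
  fix z0
  have "compact (f ` cball z0 2)"
    using cholomorphic_continuous[OF assms] by (intro compact_continuous_image) auto
  then obtain M where M: "\<And>z. z \<in> cball z0 2 \<Longrightarrow> norm (f z) \<le> M"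
    by (meson bounded_iff compact_imp_bounded imageI)
  have M0: "0 \<le> M"
    using M[of z0] norm_ge_zero order_trans by (metis centre_in_cball zero_le_numeral)
  define g where "g = cderiv f"
  define q where "q h = inverse h *\<^sub>C (g (z0 + h) - g z0)" for h
  \<comment> \<open>Testing against an arbitrary vector reduces the Cauchy property of the difference quotients
    to scalar Cauchy estimates that are uniform in the test vector.\<close>
  have q: "norm (q h - q k) \<le> 6 * M * (cmod h + cmod k)"
    if h: "cmod h \<le> 1" "h \<noteq> 0" and k: "cmod k \<le> 1" "k \<noteq> 0" for h k
  proof (rule norm_le_if_cinner_le)
    fix w :: 'h
    define \<phi> where "\<phi> z = cinner w (f z)" for z
    have d: "(\<phi> has_field_derivative cinner w (g z)) (at z)" for z
      unfolding \<phi>_def g_def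
      by (rule cinner_has_field_derivative[OF cholomorphic_has_cderiv[OF assms]])
    then have d': "deriv \<phi> z = cinner w (g z)" for z
      by (rule DERIV_imp_deriv)
    have hol: "\<phi> holomorphic_on UNIV"
      using d by (auto simp: holomorphic_on_def field_differentiable_def)
    have b: "cmod (\<phi> z) \<le> norm w * M" if "z \<in> cball z0 2" for z
      unfolding \<phi>_def
      by (rule order_trans[OF cinner_Cauchy_Schwarz]) (simp add: M[OF that] mult_left_mono)
    have e: "cmod (cinner w (q j) - deriv (deriv \<phi>) z0) \<le> 6 * (norm w * M) * cmod j"
      if "cmod j \<le> 1" "j \<noteq> 0" for j
    proof -
      have "cinner w (q j) - deriv (deriv \<phi>) z0
          = (deriv \<phi> (z0 + j) - deriv \<phi> z0 - j * deriv (deriv \<phi>) z0) / j"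
        using that by (simp add: q_def d' cinner_scaleC_right cinner_diff_right field_simps)
      also have "cmod \<dots> \<le> 6 * (norm w * M) * (cmod j)\<^sup>2 / cmod j"
        unfolding norm_divide
        by (intro divide_right_mono entire_deriv_Taylor_bound[OF hol b] that) auto
      finally show ?thesis
        using that by (simp add: power2_eq_square)
    qed
    have "cmod (cinner w (q h - q k))
        \<le> cmod (cinner w (q h) - deriv (deriv \<phi>) z0) + cmod (cinner w (q k) - deriv (deriv \<phi>) z0)"
      unfolding cinner_diff_right by (metis norm_triangle_ineq4 diff_diff_eq2 diff_add_cancel add_diff_cancel_right' diff_diff_eq)
    also have "\<dots> \<le> 6 * (norm w * M) * cmod h + 6 * (norm w * M) * cmod k"
      using e h k by (intro add_mono) auto
    finally show "cmod (cinner w (q h - q k)) \<le> 6 * M * (cmod h + cmod k) * norm w"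
      by (simp add: algebra_simps)
  qed (use M0 in auto)
  \<comment> \<open>One sequence of increments tending to 0 is enough to produce the candidate limit
    \<open>L\<close>; the rate \<open>q\<close> then extends convergence to all increments.\<close>
  define T where "T n = complex_of_real (inverse (real (Suc n)))" for n
  have T0: "T n \<noteq> 0" and T1: "cmod (T n) \<le> 1" for n
    by (simp_all add: T_def norm_inverse inverse_le_1_iff del: of_nat_Suc)
  have Tl: "(\<lambda>n. cmod (T n)) \<longlonglongrightarrow> 0"
    unfolding T_def norm_of_real using LIMSEQ_inverse_real_of_nat by (simp add: abs_inverse)
  have "Cauchy (\<lambda>n. q (T n))"
  proof (rule metric_CauchyI)
    fix \<epsilon> :: real assume "0 < \<epsilon>"
    \<comment> \<open>Two increments below \<open>\<delta>\<close> give the bound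
      \<open>12 * M * \<delta>\<close>. The summand 1 keeps the denominator positive when
      \<open>M = 0\<close> and makes the inequality strict.\<close>
    define \<delta> where "\<delta> = \<epsilon> / (12 * M + 1)"
    have \<delta>: "0 < \<delta>" "12 * M * \<delta> + \<delta> = \<epsilon>"
      using M0 \<open>0 < \<epsilon>\<close> by (simp_all add: \<delta>_def add_divide_distrib[symmetric] distrib_right[of "12 * M" 1, simplified, symmetric])
    obtain N where N: "\<And>n. n \<ge> N \<Longrightarrow> cmod (T n) < \<delta>"
      using LIMSEQ_D[OF Tl \<delta>(1)] by fastforce
    have "dist (q (T m)) (q (T n)) < \<epsilon>" if "m \<ge> N" "n \<ge> N" for m n
    proof -
      have "dist (q (T m)) (q (T n)) \<le> 6 * M * (cmod (T m) + cmod (T n))"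
        unfolding dist_norm by (intro q T0 T1)
      also have "\<dots> \<le> 6 * M * (\<delta> + \<delta>)"
        using N[OF that(1)] N[OF that(2)] M0 by (intro mult_left_mono add_mono) auto
      also have "\<dots> < \<epsilon>"
        using \<delta> by simp
      finally show ?thesis .
    qed
    then show "\<exists>N. \<forall>m\<ge>N. \<forall>n\<ge>N. dist (q (T m)) (q (T n)) < \<epsilon>"
      by blast
  qed
  then obtain L where L: "(\<lambda>n. q (T n)) \<longlonglongrightarrow> L"
    using Cauchy_convergent_iff convergent_def by metis
  \<comment> \<open>Let the second increment in \<open>q\<close> run through
    \<open>T n\<close>.\<close>
  have qL: "norm (q h - L) \<le> 6 * M * cmod h" if "cmod h \<le> 1" "h \<noteq> 0" for h
  proof (rule tendsto_le[OF sequentially_bot])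
    show "(\<lambda>n. 6 * M * (cmod h + cmod (T n))) \<longlonglongrightarrow> 6 * M * cmod h"
      by (rule tendsto_eq_intros Tl refl | simp)+
    show "(\<lambda>n. norm (q h - q (T n))) \<longlonglongrightarrow> norm (q h - L)"
      by (intro tendsto_intros L)
    show "\<forall>\<^sub>F n in sequentially. norm (q h - q (T n)) \<le> 6 * M * (cmod h + cmod (T n))"
      by (intro always_eventually allI q that T0 T1)
  qed
  have "((\<lambda>h. norm (g (z0 + h) - g z0 - h *\<^sub>C L) / norm h) \<longlongrightarrow> 0) (at 0)"
  proof (rule Lim_null_comparison)
    show "((\<lambda>h. 6 * M * cmod h) \<longlongrightarrow> 0) (at 0)"
      by (rule tendsto_eq_intros refl | simp)+
    have "norm (g (z0 + h) - g z0 - h *\<^sub>C L) / norm h \<le> 6 * M * cmod h" if "h \<noteq> 0" "cmod h < 1" for h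
    proof -
      have "g (z0 + h) - g z0 - h *\<^sub>C L = h *\<^sub>C (q h - L)"
        using that by (simp add: q_def cv.scale_right_diff_distrib)
      then show ?thesis
        using qL[of h] that by (simp add: norm_scaleC)
    qed
    then show "\<forall>\<^sub>F h in at 0. norm (norm (g (z0 + h) - g z0 - h *\<^sub>C L) / norm h) \<le> 6 * M * cmod h"
      unfolding eventually_at by (intro exI[of _ 1]) auto
  qed
  then have "has_cderiv g L z0"
    unfolding has_cderiv_def has_derivative_at
    by (simp add: bounded_bilinear.bounded_linear_left[OF bounded_bilinear_scaleC])
  then show "\<exists>v. has_cderiv (cderiv f) v z0"
    unfolding g_def by blast
qed

lemma cholomorphic_cderivs:
  fixes f :: "complex \<Rightarrow> 'h::chilbert"
  assumes "cholomorphic f"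
  shows "cholomorphic (cderivs k f)"
  by (induction k) (simp_all add: cderivs_def assms cholomorphic_cderiv)

lemma has_cderiv_cderivs:
  fixes f :: "complex \<Rightarrow> 'h::chilbert"
  assumes "cholomorphic f"
  shows "has_cderiv (cderivs k f) (cderivs (Suc k) f z) z"
  using cholomorphic_has_cderiv[OF cholomorphic_cderivs[OF assms]] by (simp add: cderivs_def)

lemma has_wirtinger_cderivs:
  fixes f :: "complex \<Rightarrow> 'h::chilbert"
  assumes "cholomorphic f"
  shows "has_wirtinger (cderivs k f) (cderivs (Suc k) f) (\<lambda>z. 0)"
  using has_cderiv_cderivs[OF assms] cholomorphic_continuous[OF cholomorphic_cderivs[OF assms]]
  by (simp add: has_wirtinger_def has_cderiv_def)

section \<open>Integration over fundamental domains\<close>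

lemma lebesgue_distr_translation: "distr lebesgue lebesgue (\<lambda>x. t + x) = (lebesgue :: 'a::euclidean_space measure)"
  using lebesgue_affine_euclidean[of "\<lambda>_. 1" t]
  by (simp add: euclidean_representation density_1)

lemma lebesgue_measurable_translation: "(\<lambda>x. t + x) \<in> lebesgue \<rightarrow>\<^sub>M (lebesgue :: 'a::euclidean_space measure)"
  using lebesgue_affine_measurable[of "\<lambda>_. 1" t]
  by (simp add: euclidean_representation)

lemma nn_integral_lebesgue_translation:
  fixes g :: "'a::euclidean_space \<Rightarrow> ennreal"
  assumes "g \<in> borel_measurable lebesgue"
  shows "(\<integral>\<^sup>+x. g (t + x) \<partial>lebesgue) = (\<integral>\<^sup>+x. g x \<partial>lebesgue)"
  using nn_integral_distr[OF lebesgue_measurable_translation, of g t] assms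
  by (simp add: lebesgue_distr_translation)

section \<open>Lattices, fundamental domains and periodic functions\<close>

lemma countable_lattice: "countable (lattice w1 w2)"
proof -
  have "lattice w1 w2 = (\<lambda>(m, n). of_int m * w1 + of_int n * w2) ` UNIV"
    by (auto simp: lattice_def)
  then show ?thesis
    by simp
qed

lemma lattice_uminus: "l \<in> lattice w1 w2 \<Longrightarrow> - l \<in> lattice w1 w2"
proof -
  assume "l \<in> lattice w1 w2"
  then obtain m n where "l = of_int m * w1 + of_int n * w2"
    by (auto simp: lattice_def)
  then have "- l = of_int (- m) * w1 + of_int (- n) * w2"
    by simp
  then show ?thesis
    unfolding lattice_def by blast
qed

text \<open>Unfolding: each lattice orbit meets \<open>E\<close> exactly once, so the integrand over
  \<open>D\<close> may be multiplied by the sum over \<open>l\<close> of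
  \<open>indicator E (z + l)\<close>. Exchanging sum and integral and translating by
  \<open>l\<close> moves the roles from \<open>D\<close> to \<open>E\<close>, and the sum over
  \<open>D\<close> is again 1. With nonnegative integrands the exchange needs only measurability and
  a countable lattice.\<close>

lemma nn_integral_fundamental_domain_eq:
  assumes D: "fundamental_domain (lattice w1 w2) D" and E: "fundamental_domain (lattice w1 w2) E"
    and g: "g \<in> borel_measurable lebesgue"
    and per: "\<And>l z. l \<in> lattice w1 w2 \<Longrightarrow> g (z + l) = g z"
  shows "(\<integral>\<^sup>+z. g z * indicator D z \<partial>lebesgue) = (\<integral>\<^sup>+z. g z * indicator E z \<partial>lebesgue)"
proof -
  let ?L = "lattice w1 w2"
  have sets: "D \<in> sets lebesgue" "E \<in> sets lebesgue"
    using D E by (auto simp: fundamental_domain_def)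
  have one: "(\<integral>\<^sup>+l. indicator F (z + l) \<partial>count_space ?L) = 1" if "fundamental_domain ?L F" for F z
  proof -
    obtain l0 where l0: "l0 \<in> ?L" "z + l0 \<in> F" "\<And>l. l \<in> ?L \<Longrightarrow> z + l \<in> F \<Longrightarrow> l = l0"
      using \<open>fundamental_domain ?L F\<close> unfolding fundamental_domain_def by metis
    have "(\<integral>\<^sup>+l. indicator F (z + l) \<partial>count_space ?L) = (\<integral>\<^sup>+l. indicator {l0} l \<partial>count_space ?L)"
      using l0(1,2) by (intro nn_integral_cong) (auto simp: indicator_def dest: l0(3))
    also have "\<dots> = 1"
      using l0(1) by (subst nn_integral_indicator) auto
    finally show ?thesis .
  qed
  have meas: "(\<lambda>z. indicator F (z + l) :: ennreal) \<in> borel_measurable lebesgue" if "F \<in> sets lebesgue" for F and l :: complex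
    using measurable_compose[OF lebesgue_measurable_translation borel_measurable_indicator[OF that], of l]
    by (simp add: add.commute)
  have "(\<integral>\<^sup>+z. g z * indicator D z \<partial>lebesgue)
      = (\<integral>\<^sup>+z. \<integral>\<^sup>+l. g z * indicator D z * indicator E (z + l) \<partial>count_space ?L \<partial>lebesgue)"
    by (intro nn_integral_cong) (simp add: nn_integral_cmult one[OF E])
  also have "\<dots> = (\<integral>\<^sup>+l. \<integral>\<^sup>+z. g z * indicator D z * indicator E (z + l) \<partial>lebesgue \<partial>count_space ?L)"
    by (rule nn_integral_count_space_nn_integral[OF countable_lattice])
      (intro borel_measurable_times_ennreal borel_measurable_indicator g meas sets)
  also have "\<dots> = (\<integral>\<^sup>+l. \<integral>\<^sup>+z. g z * indicator E z * indicator D (z + - l) \<partial>lebesgue \<partial>count_space ?L)"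
  proof (rule nn_integral_cong)
    fix l assume "l \<in> space (count_space ?L)"
    then have l: "l \<in> ?L" by simp
    have "(\<integral>\<^sup>+z. g z * indicator E z * indicator D (z + - l) \<partial>lebesgue)
        = (\<integral>\<^sup>+z. g (l + z) * indicator E (l + z) * indicator D (l + z + - l) \<partial>lebesgue)"
      by (rule nn_integral_lebesgue_translation[symmetric])
        (intro borel_measurable_times_ennreal borel_measurable_indicator g meas sets)
    also have "\<dots> = (\<integral>\<^sup>+z. g z * indicator D z * indicator E (z + l) \<partial>lebesgue)"
      using per[OF l] by (intro nn_integral_cong) (simp add: ac_simps)
    finally show "(\<integral>\<^sup>+z. g z * indicator D z * indicator E (z + l) \<partial>lebesgue)
        = (\<integral>\<^sup>+z. g z * indicator E z * indicator D (z + - l) \<partial>lebesgue)" ..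
  qed
  also have "\<dots> = (\<integral>\<^sup>+z. \<integral>\<^sup>+l. g z * indicator E z * indicator D (z + - l) \<partial>count_space ?L \<partial>lebesgue)"
    by (rule nn_integral_count_space_nn_integral[OF countable_lattice, symmetric])
      (intro borel_measurable_times_ennreal borel_measurable_indicator g meas sets)
  \<comment> \<open>The lattice is symmetric under negation, so the sum may be reindexed to the form
    in which \<open>one\<close> applies.\<close>
  also have "\<dots> = (\<integral>\<^sup>+z. \<integral>\<^sup>+l. g z * indicator E z * indicator D (z + l) \<partial>count_space ?L \<partial>lebesgue)"
  proof (rule nn_integral_cong)
    fix z
    have "bij_betw uminus ?L ?L"
      by (rule bij_betwI[where g = uminus]) (auto simp: lattice_uminus)
    then show "(\<integral>\<^sup>+l. g z * indicator E z * indicator D (z + - l) \<partial>count_space ?L)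
        = (\<integral>\<^sup>+l. g z * indicator E z * indicator D (z + l) \<partial>count_space ?L)"
      by (rule nn_integral_bij_count_space[where f = "\<lambda>l. g z * indicator E z * indicator D (z + l)"])
  qed
  also have "\<dots> = (\<integral>\<^sup>+z. g z * indicator E z \<partial>lebesgue)"
    by (intro nn_integral_cong) (simp add: nn_integral_cmult one[OF D])
  finally show ?thesis .
qed

lemma emeasure_fundamental_domain_eq:
  assumes "fundamental_domain (lattice w1 w2) D" "fundamental_domain (lattice w1 w2) E"
  shows "emeasure lebesgue D = emeasure lebesgue E"
  using nn_integral_fundamental_domain_eq[OF assms, of "\<lambda>_. 1"] assms
  by (simp add: fundamental_domain_def)

text \<open>A given fundamental domain may be unbounded. The half-open period parallelogram is a
  bounded one, on which compactness arguments for periodic functions can run.\<close>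

lemma bounded_fundamental_domain:
  assumes "Im (cnj w1 * w2) \<noteq> 0"
  obtains P where "fundamental_domain (lattice w1 w2) P" "P \<subseteq> cball 0 (cmod w1 + cmod w2)"
proof
  \<comment> \<open>Coordinates of \<open>z\<close> in the basis \<open>w1\<close>,
    \<open>w2\<close> by Cramer's rule; the denominator is the signed area of the period
    parallelogram. The lattice vector that brings \<open>z\<close> into \<open>P\<close> subtracts
    the floors of both coordinates.\<close>
  define s t where "s z = - Im (cnj w2 * z) / Im (cnj w1 * w2)"
    and "t z = Im (cnj w1 * z) / Im (cnj w1 * w2)" for z
  define P where "P = {z. 0 \<le> s z \<and> s z < 1 \<and> 0 \<le> t z \<and> t z < 1}"
  define d where "d = Im (cnj w1 * w2)"
  have d: "d \<noteq> 0" "d = Re w1 * Im w2 - Im w1 * Re w2"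
    using assms by (simp_all add: d_def algebra_simps)
  have sd: "d * s z = Im w2 * Re z - Re w2 * Im z" and td: "d * t z = Re w1 * Im z - Im w1 * Re z" for z
    unfolding s_def t_def d_def[symmetric] using d(1) by simp_all
  have z: "z = of_real (s z) * w1 + of_real (t z) * w2" for z
  proof -
    have "d * Re z = (d * s z) * Re w1 + (d * t z) * Re w2"
      unfolding sd td unfolding d(2) by (simp add: algebra_simps)
    moreover have "d * Im z = (d * s z) * Im w1 + (d * t z) * Im w2"
      unfolding sd td unfolding d(2) by (simp add: algebra_simps)
    ultimately show ?thesis
      using d(1) by (simp add: complex_eq_iff mult.assoc flip: distrib_left)
  qed
  have s: "s (z + (of_int m * w1 + of_int n * w2)) = s z + of_int m" for z m n
  proof -
    have "d * s (z + (of_int m * w1 + of_int n * w2)) = d * (s z + of_int m)"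
      unfolding distrib_left sd unfolding d(2) by (simp add: algebra_simps)
    then show ?thesis using d(1) by simp
  qed
  have t: "t (z + (of_int m * w1 + of_int n * w2)) = t z + of_int n" for z m n
  proof -
    have "d * t (z + (of_int m * w1 + of_int n * w2)) = d * (t z + of_int n)"
      unfolding distrib_left td unfolding d(2) by (simp add: algebra_simps)
    then show ?thesis using d(1) by simp
  qed
  have "P \<in> sets borel"
    unfolding P_def s_def t_def by measurable
  then have "P \<in> sets lebesgue"
    by (simp add: sets_completionI_sets)
  moreover have "\<exists>!l. l \<in> lattice w1 w2 \<and> z + l \<in> P" for z
  proof (rule ex1I)
    show "of_int (- \<lfloor>s z\<rfloor>) * w1 + of_int (- \<lfloor>t z\<rfloor>) * w2 \<in> lattice w1 w2 \<and>
      z + (of_int (- \<lfloor>s z\<rfloor>) * w1 + of_int (- \<lfloor>t z\<rfloor>) * w2) \<in> P"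
      unfolding P_def mem_Collect_eq s t by (intro conjI; (linarith)?) (unfold lattice_def, blast)
  next
    fix l assume l: "l \<in> lattice w1 w2 \<and> z + l \<in> P"
    then obtain m n where mn: "l = of_int m * w1 + of_int n * w2"
      by (auto simp: lattice_def)
    with l have "0 \<le> s z + of_int m \<and> s z + of_int m < 1 \<and> 0 \<le> t z + of_int n \<and> t z + of_int n < 1"
      unfolding P_def by (simp add: s t)
    then have "m = - \<lfloor>s z\<rfloor>" "n = - \<lfloor>t z\<rfloor>"
      by linarith+
    with mn show "l = of_int (- \<lfloor>s z\<rfloor>) * w1 + of_int (- \<lfloor>t z\<rfloor>) * w2"
      by simp
  qed
  ultimately show "fundamental_domain (lattice w1 w2) P"
    by (simp add: fundamental_domain_def)
  have "cmod z \<le> cmod w1 + cmod w2" if "z \<in> P" for z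
  proof -
    have "cmod z = cmod (of_real (s z) * w1 + of_real (t z) * w2)"
      using z by (rule arg_cong)
    also have "\<dots> \<le> \<bar>s z\<bar> * cmod w1 + \<bar>t z\<bar> * cmod w2"
      by (rule order_trans[OF norm_triangle_ineq]) (simp add: norm_mult)
    also have "\<dots> \<le> 1 * cmod w1 + 1 * cmod w2"
      using that by (intro add_mono mult_right_mono) (auto simp: P_def)
    finally show ?thesis by simp
  qed
  then show "P \<subseteq> cball 0 (cmod w1 + cmod w2)"
    by auto
qed

lemma periodic_bounded:
  fixes g :: "complex \<Rightarrow> 'a::real_normed_vector"
  assumes "Im (cnj w1 * w2) \<noteq> 0" "continuous_on UNIV g"
    and per: "\<And>l z. l \<in> lattice w1 w2 \<Longrightarrow> g (z + l) = g z"
  obtains K where "\<And>z. norm (g z) \<le> K"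
proof -
  obtain P where P: "fundamental_domain (lattice w1 w2) P" "P \<subseteq> cball 0 (cmod w1 + cmod w2)"
    using bounded_fundamental_domain[OF assms(1)] .
  have "compact (g ` cball 0 (cmod w1 + cmod w2))"
    using assms(2) by (intro compact_continuous_image) (auto intro: continuous_on_subset)
  then obtain K where K: "\<And>z. z \<in> cball 0 (cmod w1 + cmod w2) \<Longrightarrow> norm (g z) \<le> K"
    by (meson bounded_iff compact_imp_bounded imageI)
  have "norm (g z) \<le> K" for z
  proof -
    obtain l where "l \<in> lattice w1 w2" "z + l \<in> P"
      using P(1) unfolding fundamental_domain_def by blast
    then show ?thesis
      using K[of "z + l"] P(2) per[of l z] by auto
  qed
  then show ?thesis by (rule that)
qed

text \<open>All fundamental domains of one lattice have equal measure, and the parallelogram is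
  bounded.\<close>

lemma fundamental_domain_finite_measure:
  assumes "Im (cnj w1 * w2) \<noteq> 0" "fundamental_domain (lattice w1 w2) D"
  shows "D \<in> lmeasurable"
proof -
  obtain P where P: "fundamental_domain (lattice w1 w2) P" "P \<subseteq> cball 0 (cmod w1 + cmod w2)"
    using bounded_fundamental_domain[OF assms(1)] .
  have "D \<in> sets lebesgue" "P \<in> sets lebesgue"
    using assms P by (auto simp: fundamental_domain_def)
  moreover have "emeasure lebesgue D = emeasure lebesgue P"
    by (rule emeasure_fundamental_domain_eq[OF assms(2) P(1)])
  moreover have "P \<in> lmeasurable"
    using P(2) calculation(2) bounded_subset bounded_set_imp_lmeasurable by blast
  ultimately show ?thesis
    by (simp add: fmeasurable_def del: emeasure_completion)
qed

lemma periodic_set_integrable: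
  fixes g :: "complex \<Rightarrow> real"
  assumes "Im (cnj w1 * w2) \<noteq> 0" "fundamental_domain (lattice w1 w2) D" "continuous_on UNIV g"
    and per: "\<And>l z. l \<in> lattice w1 w2 \<Longrightarrow> g (z + l) = g z"
  shows "set_integrable lebesgue D g"
proof -
  obtain K where K: "\<And>z. norm (g z) \<le> K"
    using periodic_bounded[OF assms(1,3,4)] by blast
  have [measurable]: "D \<in> sets lebesgue"
    using assms(2) by (auto simp: fundamental_domain_def)
  have [measurable]: "g \<in> borel_measurable lebesgue"
    using borel_measurable_continuous_onI[OF assms(3)] by (simp add: measurable_completion)
  have "set_integrable lebesgue D (\<lambda>_. K)"
    using fundamental_domain_finite_measure[OF assms(1,2)]
    by (simp add: absolutely_integrable_on_const)
  then show ?thesis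
    unfolding set_integrable_def
    by (rule Bochner_Integration.integrable_bound)
      (use K order_trans[OF K abs_ge_self] in \<open>auto simp: indicator_def\<close>)
qed

lemma integral_fundamental_domain_eq:
  fixes g :: "complex \<Rightarrow> real"
  assumes "Im (cnj w1 * w2) \<noteq> 0" "fundamental_domain (lattice w1 w2) D"
    and "fundamental_domain (lattice w1 w2) E" "continuous_on UNIV g"
    and per: "\<And>l z. l \<in> lattice w1 w2 \<Longrightarrow> g (z + l) = g z"
  shows "(LINT z:D|lebesgue. g z) = (LINT z:E|lebesgue. g z)"
proof -
  obtain K where K: "\<And>z. norm (g z) \<le> K"
    using periodic_bounded[OF assms(1,4,5)] by blast
  \<comment> \<open>Adding the bound \<open>K\<close> makes the integrand nonnegative, so the
    unfolding result applies; the constant contributes equally over \<open>D\<close> and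
    \<open>E\<close> because their measures agree.\<close>
  have pos: "0 \<le> g z + K" for z
    using K[of z] by (simp add: abs_le_iff)
  have c: "continuous_on UNIV (\<lambda>z. g z + K)"
    using assms(4) by (intro continuous_intros)
  then have m [measurable]: "(\<lambda>z. g z + K) \<in> borel_measurable lebesgue"
    by (simp add: measurable_completion borel_measurable_continuous_onI)
  have sets [measurable]: "D \<in> sets lebesgue" "E \<in> sets lebesgue"
    using assms by (auto simp: fundamental_domain_def)
  have nn: "(LINT z:F|lebesgue. g z + K) = enn2real (\<integral>\<^sup>+z. ennreal (g z + K) * indicator F z \<partial>lebesgue)"
    if "F \<in> sets lebesgue" for F
    unfolding set_lebesgue_integral_def using pos that
    by (subst integral_eq_nn_integral)
      (auto intro!: arg_cong[of _ _ enn2real] nn_integral_cong simp: indicator_def)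
  have "(LINT z:D|lebesgue. g z + K) = (LINT z:E|lebesgue. g z + K)"
    unfolding nn[OF sets(1)] nn[OF sets(2)]
    by (subst nn_integral_fundamental_domain_eq[OF assms(2,3)]) (auto simp: per)
  moreover have "(LINT z:D|lebesgue. K) = (LINT z:E|lebesgue. K)"
    using emeasure_fundamental_domain_eq[OF assms(2,3)]
    by (simp add: set_lebesgue_integral_def measure_def)
  moreover have i: "set_integrable lebesgue D g" "set_integrable lebesgue E g"
    "set_integrable lebesgue D (\<lambda>_. K)" "set_integrable lebesgue E (\<lambda>_. K)"
    using assms by (auto intro!: periodic_set_integrable[OF assms(1)])
  ultimately show ?thesis
    by (simp add: set_integral_add)
qed


section \<open>Translation invariance of period integrals\<close>

lemma fundamental_domain_translation:
  assumes "fundamental_domain (lattice w1 w2) D"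
  shows "fundamental_domain (lattice w1 w2) ((+) w ` D)"
proof -
  have "x \<in> (+) w ` D \<longleftrightarrow> x - w \<in> D" for x
    by (auto simp: image_iff) (metis add.commute diff_add_cancel)
  then have "z + l \<in> (+) w ` D \<longleftrightarrow> (z - w) + l \<in> D" for z l
    by (simp add: algebra_simps)
  then show ?thesis
    using assms by (simp add: fundamental_domain_def lebesgue_sets_translation)
qed

text \<open>Translating the function amounts to moving the domain by \<open>w\<close>, and the moved
  set is again a fundamental domain of the same lattice.\<close>

lemma integral_fundamental_domain_shift:
  fixes g :: "complex \<Rightarrow> real"
  assumes "Im (cnj w1 * w2) \<noteq> 0" "fundamental_domain (lattice w1 w2) D" "continuous_on UNIV g"
    and per: "\<And>l z. l \<in> lattice w1 w2 \<Longrightarrow> g (z + l) = g z"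
  shows "(LINT z:D|lebesgue. g (z + w)) = (LINT z:D|lebesgue. g z)"
proof -
  let ?E = "(+) w ` D"
  have E: "fundamental_domain (lattice w1 w2) ?E"
    by (rule fundamental_domain_translation[OF assms(2)])
  then have [measurable]: "?E \<in> sets lebesgue"
    by (simp add: fundamental_domain_def)
  have [measurable]: "g \<in> borel_measurable lebesgue"
    using borel_measurable_continuous_onI[OF assms(3)] by (simp add: measurable_completion)
  have "(LINT z:?E|lebesgue. g z) = (LINT z|distr lebesgue lebesgue ((+) w). indicator ?E z *\<^sub>R g z)"
    using lebesgue_distr_translation[of w] by (simp add: set_lebesgue_integral_def)
  also have "\<dots> = (LINT z|lebesgue. indicator ?E (w + z) *\<^sub>R g (w + z))"
    by (rule integral_distr[OF lebesgue_measurable_translation]) measurable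
  also have "\<dots> = (LINT z:D|lebesgue. g (z + w))"
    unfolding set_lebesgue_integral_def
    by (intro Bochner_Integration.integral_cong) (auto simp: indicator_def add.commute)
  finally show ?thesis
    using integral_fundamental_domain_eq[OF assms(1,2) E assms(3,4)] by simp
qed

text \<open>This takes the place of Stokes' theorem. The difference quotients integrate to zero by
  shift invariance, and dominated convergence passes this on to the derivative. No boundary appears,
  so \<open>D\<close> can be any measurable fundamental domain.\<close>

lemma integral_fundamental_domain_directional_derivative:
  fixes g :: "complex \<Rightarrow> real"
  assumes lat: "Im (cnj w1 * w2) \<noteq> 0" and D: "fundamental_domain (lattice w1 w2) D"
    and der: "\<And>z. (g has_derivative g' z) (at z)" and cont: "continuous_on UNIV (\<lambda>z. g' z e)"
    and per: "\<And>l z. l \<in> lattice w1 w2 \<Longrightarrow> g (z + l) = g z"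
  shows "(LINT z:D|lebesgue. g' z e) = 0"
proof -
  have contg: "continuous_on UNIV g"
    using der by (meson continuous_at_imp_continuous_on has_derivative_continuous)
  have per': "g' (z + l) e = g' z e" if "l \<in> lattice w1 w2" for l z
  proof -
    have "((\<lambda>z. g (z + l)) has_derivative g' (z + l)) (at z)"
      by (rule has_derivative_compose[OF _ der, of "\<lambda>z. z + l" "\<lambda>h. h", simplified])
        (auto intro!: derivative_eq_intros)
    then have "(g has_derivative g' (z + l)) (at z)"
      using per[OF that] by simp
    then show ?thesis
      using has_derivative_unique[OF der] by metis
  qed
  obtain K where K: "\<And>z. norm (g' z e) \<le> K"
    using periodic_bounded[OF lat cont per'] by blast
  have ray: "((\<lambda>t. g (z + complex_of_real t * e)) has_real_derivative g' (z + complex_of_real t * e) e) (at t)" for z t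
  proof -
    have "((\<lambda>t. z + complex_of_real t * e) has_derivative (\<lambda>h. h *\<^sub>R e)) (at t)"
      by (auto intro!: derivative_eq_intros simp: scaleR_conv_of_real)
    from has_derivative_compose[OF this der]
    have "((\<lambda>t. g (z + complex_of_real t * e)) has_derivative
        (\<lambda>h. g' (z + complex_of_real t * e) (h *\<^sub>R e))) (at t)" .
    moreover have "g' x (h *\<^sub>R e) = g' x e * h" for x h
      using linear_scale[OF has_derivative_linear[OF der]] by simp
    ultimately show ?thesis
      by (simp add: has_field_derivative_def)
  qed
  define T where "T n = inverse (real (Suc n))" for n
  define Q where "Q n z = (g (z + complex_of_real (T n) * e) - g z) / T n" for n z
  have T: "T n > 0" for n
    by (simp add: T_def)
  \<comment> \<open>The mean value theorem along the segment bounds every quotient by the supremum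
    of the periodic, hence bounded, derivative. A constant dominates because \<open>D\<close> has
    finite measure.\<close>
  have Qb: "\<bar>Q n z\<bar> \<le> K" for n z
  proof -
    obtain x where "g (z + complex_of_real (T n) * e) - g (z + complex_of_real 0 * e)
        = (T n - 0) * g' (z + complex_of_real x * e) e"
      using MVT2[OF T ray] by blast
    then have "Q n z = g' (z + complex_of_real x * e) e"
      using T[of n] by (simp add: Q_def)
    then show ?thesis
      using K by simp
  qed
  have Qlim: "(\<lambda>n. Q n z) \<longlonglongrightarrow> g' z e" for z
  proof -
    have "((\<lambda>h. (g (z + complex_of_real h * e) - g z) / h) \<longlongrightarrow> g' z e) (at 0)"
      using ray[of z 0] by (simp add: DERIV_def)
    moreover have "filterlim T (at 0) sequentially"
      unfolding T_def by (rule filterlim_atI) (simp_all add: LIMSEQ_inverse_real_of_nat del: of_nat_Suc)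
    ultimately show ?thesis
      unfolding Q_def by (rule filterlim_compose)
  qed
  have gs: "continuous_on UNIV (\<lambda>z. g (z + w))" for w
    by (rule continuous_on_compose2[OF contg]) (auto intro!: continuous_intros)
  have pers: "g (z + l + w) = g (z + w)" if "l \<in> lattice w1 w2" for z l w
    using per[OF that, of "z + w"] by (simp add: ac_simps)
  have Q0: "(LINT z:D|lebesgue. Q n z) = 0" for n
  proof -
    let ?w = "complex_of_real (T n) * e"
    have "(LINT z:D|lebesgue. Q n z) = (LINT z:D|lebesgue. g (z + ?w) - g z) / T n"
      unfolding Q_def by simp
    also have "(LINT z:D|lebesgue. g (z + ?w) - g z) = (LINT z:D|lebesgue. g (z + ?w)) - (LINT z:D|lebesgue. g z)"
      by (rule set_integral_diff; rule periodic_set_integrable[OF lat D]) (use gs contg per pers in blast)+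
    also have "\<dots> = 0"
      using integral_fundamental_domain_shift[OF lat D contg per] by simp
    finally show ?thesis by simp
  qed
  have [measurable]: "D \<in> sets lebesgue"
    using D by (simp add: fundamental_domain_def)
  have meas: "h \<in> borel_measurable lebesgue" if "continuous_on UNIV h" for h :: "complex \<Rightarrow> real"
    using borel_measurable_continuous_onI[OF that] by (simp add: measurable_completion)
  have [measurable]: "(\<lambda>z. g' z e) \<in> borel_measurable lebesgue" "Q n \<in> borel_measurable lebesgue" for n
    unfolding Q_def using gs contg cont T[of n] by (auto intro!: meas continuous_intros)
  have "(\<lambda>n. LINT z|lebesgue. indicator D z *\<^sub>R Q n z) \<longlonglongrightarrow> (LINT z|lebesgue. indicator D z *\<^sub>R g' z e)"
  proof (rule integral_dominated_convergence[where w = "\<lambda>z. indicator D z *\<^sub>R K"])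
    show "integrable lebesgue (\<lambda>z. indicator D z *\<^sub>R K)"
      using periodic_set_integrable[OF lat D, of "\<lambda>_. K"] by (simp add: set_integrable_def)
    show "AE z in lebesgue. (\<lambda>n. indicator D z *\<^sub>R Q n z) \<longlonglongrightarrow> indicator D z *\<^sub>R g' z e"
      by (intro AE_I2 tendsto_intros Qlim)
    show "AE z in lebesgue. norm (indicator D z *\<^sub>R Q n z) \<le> indicator D z *\<^sub>R K" for n
      using Qb by (intro AE_I2) (auto simp: indicator_def)
  qed measurable
  then show ?thesis
    using Q0 by (simp add: set_lebesgue_integral_def LIMSEQ_const_iff)
qed

section \<open>Gram--Schmidt orthogonalisation\<close>

text \<open>Leaving out the normalisation keeps square roots out of the derivatives. Where
  \<open>gram_schmidt e k\<close> vanishes, division by zero gives the coefficient 0, so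
  orthogonality holds even for dependent sequences.\<close>

function gram_schmidt :: "(nat \<Rightarrow> 'a::cinner_space) \<Rightarrow> nat \<Rightarrow> 'a" where
  "gram_schmidt e n = e n - (\<Sum>k<n. (cinner (gram_schmidt e k) (e n) / cinner (gram_schmidt e k) (gram_schmidt e k)) *\<^sub>C gram_schmidt e k)"
  by auto
termination by (relation "Wellfounded.measure snd") auto

declare gram_schmidt.simps [simp del]

abbreviation seq_span :: "(nat \<Rightarrow> 'a::cvec) \<Rightarrow> nat \<Rightarrow> 'a set" where
  "seq_span e n \<equiv> cv.span (e ` {..<n})"

lemma seq_span_mono: "m \<le> n \<Longrightarrow> x \<in> seq_span e m \<Longrightarrow> x \<in> seq_span e n"
  by (meson cv.span_mono image_mono lessThan_subset_iff subsetD)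

lemma seq_span_base: "k < n \<Longrightarrow> e k \<in> seq_span e n"
  by (simp add: cv.span_base)

lemma seq_span_coeffs:
  assumes "x \<in> seq_span e n"
  shows "\<exists>c. x = (\<Sum>k<n. c k *\<^sub>C e k)"
  using assms
proof (induction rule: cv.span_induct_alt)
  case base
  show ?case by (rule exI[of _ "\<lambda>_. 0"]) simp
next
  case (step a x y)
  then obtain j c where j: "j < n" "x = e j" and c: "y = (\<Sum>k<n. c k *\<^sub>C e k)"
    by blast
  have "(\<Sum>k<n. ((if k = j then a else 0) + c k) *\<^sub>C e k) = a *\<^sub>C x + y"
  proof -
    have "(\<Sum>k<n. (if k = j then a else 0) *\<^sub>C e k) = (\<Sum>k<n. if k = j then a *\<^sub>C e k else 0)"
      by (intro sum.cong) auto
    then show ?thesis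
      using j c by (simp add: scaleC_add_left sum.distrib)
  qed
  then show ?case
    by (intro exI[of _ "\<lambda>k. (if k = j then a else 0) + c k"]) simp
qed

lemma gram_schmidt_in_span: "gram_schmidt e n \<in> seq_span e (Suc n)"
proof (induction n rule: less_induct)
  case (less n)
  have "gram_schmidt e k \<in> seq_span e (Suc n)" if "k < n" for k
    using seq_span_mono[OF _ less[OF that], of "Suc n"] that by simp
  then show ?case
    by (subst gram_schmidt.simps) (intro cv.span_diff cv.span_sum cv.span_scale seq_span_base; simp)
qed

lemma diff_gram_schmidt_in_span: "e n - gram_schmidt e n \<in> seq_span e n"
proof -
  have "gram_schmidt e k \<in> seq_span e n" if "k < n" for k
    using seq_span_mono[OF _ gram_schmidt_in_span, of k n e] that by simp
  then have "(\<Sum>k<n. (cinner (gram_schmidt e k) (e n) / cinner (gram_schmidt e k) (gram_schmidt e k)) *\<^sub>C gram_schmidt e k) \<in> seq_span e n"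
    by (intro cv.span_sum cv.span_scale) simp
  then show ?thesis
    by (subst gram_schmidt.simps) simp
qed

lemma seq_span_gram_schmidt: "seq_span (gram_schmidt e) n = seq_span e n"
proof (rule antisym)
  have "gram_schmidt e k \<in> seq_span e n" if "k < n" for k
    using seq_span_mono[OF _ gram_schmidt_in_span, of k n e] that by simp
  then show "seq_span (gram_schmidt e) n \<subseteq> seq_span e n"
    by (intro cv.span_minimal cv.subspace_span) auto
  have "e k \<in> seq_span (gram_schmidt e) n" if "k < n" for k
  proof -
    have "gram_schmidt e j \<in> seq_span (gram_schmidt e) n" if "j \<le> k" for j
      using that \<open>k < n\<close> by (intro seq_span_base) simp
    then have "gram_schmidt e k + (\<Sum>j<k. (cinner (gram_schmidt e j) (e k) / cinner (gram_schmidt e j) (gram_schmidt e j)) *\<^sub>C gram_schmidt e j) \<in> seq_span (gram_schmidt e) n"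
      by (intro cv.span_add cv.span_sum cv.span_scale) simp_all
    also have "gram_schmidt e k + (\<Sum>j<k. (cinner (gram_schmidt e j) (e k) / cinner (gram_schmidt e j) (gram_schmidt e j)) *\<^sub>C gram_schmidt e j) = e k"
      by (subst gram_schmidt.simps) simp
    finally show ?thesis .
  qed
  then show "seq_span e n \<subseteq> seq_span (gram_schmidt e) n"
    by (intro cv.span_minimal cv.subspace_span) auto
qed

lemma gram_schmidt_orthogonal_less: "j < n \<Longrightarrow> cinner (gram_schmidt e j) (gram_schmidt e n) = 0"
proof (induction n arbitrary: j rule: less_induct)
  case (less n)
  have "cinner (gram_schmidt e j) (gram_schmidt e k) = 0" if "k < n" "k \<noteq> j" for k
    using less.IH[of k j] less.IH[of j k] less.prems that cinner_commute_zero[of "gram_schmidt e j" "gram_schmidt e k"]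
    by (cases "j < k") auto
  then have "(\<Sum>k<n. cinner (gram_schmidt e k) (e n) / cinner (gram_schmidt e k) (gram_schmidt e k) * cinner (gram_schmidt e j) (gram_schmidt e k))
      = (\<Sum>k<n. if k = j then cinner (gram_schmidt e k) (e n) / cinner (gram_schmidt e k) (gram_schmidt e k) * cinner (gram_schmidt e j) (gram_schmidt e k) else 0)"
    by (intro sum.cong) auto
  then have "cinner (gram_schmidt e j) (gram_schmidt e n)
      = cinner (gram_schmidt e j) (e n) - cinner (gram_schmidt e j) (e n) / cinner (gram_schmidt e j) (gram_schmidt e j) * cinner (gram_schmidt e j) (gram_schmidt e j)"
    using less.prems
    by (subst (2) gram_schmidt.simps) (simp add: cinner_diff_right cinner_sum_right cinner_scaleC_right)
  \<comment> \<open>If \<open>gram_schmidt e j\<close> is zero, every term vanishes; otherwise the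
    quotient cancels and the two terms agree.\<close>
  then show ?case
    by (cases "gram_schmidt e j = 0") (simp_all add: cinner_eq_zero_iff)
qed

lemma gram_schmidt_orthogonal: "j \<noteq> k \<Longrightarrow> cinner (gram_schmidt e j) (gram_schmidt e k) = 0"
  by (metis cinner_commute_zero gram_schmidt_orthogonal_less linorder_neqE_nat)

lemma seq_span_orthogonal_gram_schmidt:
  assumes "x \<in> seq_span e n"
  shows "cinner x (gram_schmidt e n) = 0"
proof -
  have "x \<in> seq_span (gram_schmidt e) n"
    using assms by (simp only: seq_span_gram_schmidt)
  then show ?thesis
    by (induction rule: cv.span_induct_alt) (auto simp: cinner_add_left cinner_scaleC_left gram_schmidt_orthogonal_less)
qed

lemma cinner_gram_schmidt_self: "cinner (gram_schmidt e n) (e n) = cinner (gram_schmidt e n) (gram_schmidt e n)"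
proof -
  have "cinner (gram_schmidt e n) (e n - gram_schmidt e n) = 0"
    using seq_span_orthogonal_gram_schmidt[OF diff_gram_schmidt_in_span] cinner_commute_zero by blast
  then show ?thesis
    by (simp add: cinner_diff_right)
qed

lemma gram_schmidt_expansion:
  assumes "x \<in> seq_span e n" "\<And>k. k < n \<Longrightarrow> gram_schmidt e k \<noteq> 0"
  shows "x = (\<Sum>k<n. (cinner (gram_schmidt e k) x / cinner (gram_schmidt e k) (gram_schmidt e k)) *\<^sub>C gram_schmidt e k)"
proof -
  have "x \<in> seq_span (gram_schmidt e) n"
    using assms(1) by (simp only: seq_span_gram_schmidt)
  then show ?thesis
  proof (induction rule: cv.span_induct_alt)
    case (step c x y)
    then obtain j where j: "j < n" "x = gram_schmidt e j"
      by blast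
    have "(\<Sum>k<n. (cinner (gram_schmidt e k) x / cinner (gram_schmidt e k) (gram_schmidt e k)) *\<^sub>C gram_schmidt e k) = (\<Sum>k<n. if k = j then x else 0)"
      using assms(2) j by (intro sum.cong) (auto simp: gram_schmidt_orthogonal cinner_eq_zero_iff)
    also have "\<dots> = x"
      using j by simp
    finally have *: "(\<Sum>k<n. (cinner (gram_schmidt e k) x / cinner (gram_schmidt e k) (gram_schmidt e k)) *\<^sub>C gram_schmidt e k) = x" .
    have "(\<Sum>k<n. (cinner (gram_schmidt e k) (c *\<^sub>C x + y) / cinner (gram_schmidt e k) (gram_schmidt e k)) *\<^sub>C gram_schmidt e k)
        = c *\<^sub>C (\<Sum>k<n. (cinner (gram_schmidt e k) x / cinner (gram_schmidt e k) (gram_schmidt e k)) *\<^sub>C gram_schmidt e k)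
          + (\<Sum>k<n. (cinner (gram_schmidt e k) y / cinner (gram_schmidt e k) (gram_schmidt e k)) *\<^sub>C gram_schmidt e k)"
      by (simp add: cinner_add_right cinner_scaleC_right add_divide_distrib scaleC_add_left
          sum.distrib cv.scale_sum_right)
    then show ?case
      using * step by simp
  qed simp
qed

text \<open>The definite description is resolved by uniqueness: the difference of two candidates
  lies in the span and is orthogonal to it, hence is zero.\<close>

lemma orth_proj_gram_schmidt: "orth_proj (cspan (e ` {..<n})) (e n) = e n - gram_schmidt e n"
  unfolding orth_proj_def cspan_eq_span
proof (rule the_equality)
  show "e n - gram_schmidt e n \<in> seq_span e n \<and> (\<forall>w\<in>seq_span e n. cinner w (e n - (e n - gram_schmidt e n)) = 0)"
    by (simp add: diff_gram_schmidt_in_span seq_span_orthogonal_gram_schmidt)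
next
  fix m assume m: "m \<in> seq_span e n \<and> (\<forall>w\<in>seq_span e n. cinner w (e n - m) = 0)"
  define d where "d = (e n - gram_schmidt e n) - m"
  have d: "d \<in> seq_span e n"
    unfolding d_def using m by (intro cv.span_diff diff_gram_schmidt_in_span) simp
  have "d = (e n - m) - gram_schmidt e n"
    by (simp add: d_def)
  then have "cinner d d = cinner d (e n - m) - cinner d (gram_schmidt e n)"
    by (metis cinner_diff_right)
  also have "\<dots> = 0"
    using m d by (simp add: seq_span_orthogonal_gram_schmidt)
  finally show "m = e n - gram_schmidt e n"
    by (simp add: cinner_eq_zero_iff d_def)
qed

lemma gram_schmidt_nonzero:
  assumes "derivs_indep f z n"
  shows "gram_schmidt (\<lambda>k. cderivs k f z) n \<noteq> 0"
proof
  assume "gram_schmidt (\<lambda>k. cderivs k f z) n = 0"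
  then have "cderivs n f z \<in> seq_span (\<lambda>k. cderivs k f z) n"
    using diff_gram_schmidt_in_span[of "\<lambda>k. cderivs k f z" n] by simp
  then obtain c where c: "cderivs n f z = (\<Sum>k<n. c k *\<^sub>C cderivs k f z)"
    using seq_span_coeffs by blast
  \<comment> \<open>Moving the n-th derivative to the other side gives a vanishing combination whose
    coefficient at \<open>n\<close> is -1, against independence.\<close>
  have "(\<Sum>k\<le>n. (if k = n then - 1 else c k) *\<^sub>C cderivs k f z)
      = (\<Sum>k<n. (if k = n then - 1 else c k) *\<^sub>C cderivs k f z) - cderivs n f z"
    by (simp add: lessThan_Suc_atMost[symmetric])
  also have "(\<Sum>k<n. (if k = n then - 1 else c k) *\<^sub>C cderivs k f z) = (\<Sum>k<n. c k *\<^sub>C cderivs k f z)"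
    by (intro sum.cong) auto
  finally have "(\<Sum>k\<le>n. (if k = n then - 1 else c k) *\<^sub>C cderivs k f z) = 0"
    using c by simp
  then have "\<forall>k\<le>n. (if k = n then - 1 else c k) = 0"
    by (rule mp[OF spec[OF assms[unfolded derivs_indep_def], of "\<lambda>k. if k = n then - 1 else c k"]])
  then show False
    by auto
qed

section \<open>The Landau levels of a holomorphic map\<close>

lemma pdir_eq:
  assumes "(u has_derivative u') (at z)"
  shows "pdir u h z = u' h"
proof -
  have "((\<lambda>t. z + complex_of_real t * h) has_derivative (\<lambda>t. t *\<^sub>R h)) (at 0)"
    by (auto intro!: derivative_eq_intros simp: scaleR_conv_of_real)
  from has_derivative_compose[OF this, of u u'] assms
  have "((\<lambda>t. u (z + complex_of_real t * h)) has_derivative (\<lambda>t. u' (t *\<^sub>R h))) (at 0)"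
    by simp
  moreover have "u' (t *\<^sub>R h) = t *\<^sub>R u' h" for t
    using linear_scale[OF has_derivative_linear[OF assms]] by simp
  ultimately have "((\<lambda>t. u (z + complex_of_real t * h)) has_vector_derivative u' h) (at 0)"
    by (simp add: has_vector_derivative_def)
  then show ?thesis
    unfolding pdir_def by (rule vector_derivative_at)
qed

lemma has_wirtinger_holomorphic:
  fixes \<phi> :: "complex \<Rightarrow> complex"
  assumes "\<phi> holomorphic_on UNIV"
  shows "has_wirtinger \<phi> (deriv \<phi>) (\<lambda>z. 0)"
proof -
  have "(\<phi> has_derivative (\<lambda>h. h *\<^sub>C deriv \<phi> z + cnj h *\<^sub>C 0)) (at z)" for z
    using holomorphic_derivI[OF assms, of z]
    by (simp add: has_field_derivative_def scaleC_complex_def mult_commute_abs)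
  then show ?thesis
    using holomorphic_on_imp_continuous_on[OF holomorphic_deriv[OF assms open_UNIV]]
    by (simp add: has_wirtinger_def)
qed

lemma has_wirtinger_shift:
  assumes "has_wirtinger u p q"
  shows "has_wirtinger (\<lambda>z. u (z + l)) (\<lambda>z. p (z + l)) (\<lambda>z. q (z + l))"
proof -
  have "((\<lambda>z. u (z + l)) has_derivative (\<lambda>h. h *\<^sub>C p (z + l) + cnj h *\<^sub>C q (z + l))) (at z)" for z
    by (rule has_derivative_compose[of "\<lambda>z. z + l" "\<lambda>h. h" z UNIV u, simplified])
      (use assms in \<open>auto intro!: derivative_eq_intros simp: has_wirtinger_def\<close>)
  then show ?thesis
    using assms unfolding has_wirtinger_def
    by (auto intro!: continuous_on_compose2[of UNIV _ UNIV "\<lambda>z. z + l"] continuous_intros)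
qed

section \<open>Unitary operators\<close>

context
  fixes V :: "'a::cinner_space \<Rightarrow> 'a"
  assumes V: "unitary_op V"
begin

lemma unitary_op_add: "V (x + y) = V x + V y"
  using V scaleC_one unfolding unitary_op_def by metis

lemma unitary_op_zero: "V 0 = 0"
  using unitary_op_add[of 0 0] by simp

lemma unitary_op_scaleC: "V (a *\<^sub>C x) = a *\<^sub>C V x"
  using V unitary_op_zero unfolding unitary_op_def by (metis add.right_neutral)

lemma unitary_op_cinner: "cinner (V x) (V y) = cinner x y"
  using V by (simp add: unitary_op_def)

lemma unitary_op_norm: "norm (V x) = norm x"
  by (simp add: norm_eq_sqrt_cinner unitary_op_cinner)

lemma unitary_op_diff: "V (x - y) = V x - V y"
  using unitary_op_add[of "x - y" y] by simp

lemma unitary_op_sum: "V (\<Sum>k\<in>I. g k) = (\<Sum>k\<in>I. V (g k))"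
  by (induction I rule: infinite_finite_induct) (simp_all add: unitary_op_zero unitary_op_add)

lemma unitary_op_bounded_linear: "bounded_linear V"
  by (rule bounded_linear_intro[where K = 1])
    (simp_all add: unitary_op_add scaleR_scaleC unitary_op_scaleC unitary_op_norm)

lemma has_wirtinger_unitary:
  assumes "has_wirtinger u p q"
  shows "has_wirtinger (\<lambda>z. V (u z)) (\<lambda>z. V (p z)) (\<lambda>z. V (q z))"
proof -
  have "((\<lambda>z. V (u z)) has_derivative (\<lambda>h. h *\<^sub>C V (p z) + cnj h *\<^sub>C V (q z))) (at z)" for z
    by (rule has_derivative_eq_rhs[OF bounded_linear.has_derivative[OF unitary_op_bounded_linear]])
      (use assms in \<open>auto simp: has_wirtinger_def unitary_op_add unitary_op_scaleC\<close>)
  then show ?thesis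
    using assms unfolding has_wirtinger_def
    by (auto intro!: bounded_linear.continuous_on[OF unitary_op_bounded_linear])
qed

end

text \<open>\<^term>\<open>leibniz_coeff c k j\<close> is the coefficient of the \<open>j\<close>-th derivative of \<open>g\<close> in the \<open>k\<close>-th
  derivative of \<open>c g\<close>.\<close>

primrec leibniz_coeff :: "(complex \<Rightarrow> complex) \<Rightarrow> nat \<Rightarrow> nat \<Rightarrow> complex \<Rightarrow> complex" where
  "leibniz_coeff c 0 = (\<lambda>j z. if j = 0 then c z else 0)"
| "leibniz_coeff c (Suc k) =
     (\<lambda>j z. deriv (leibniz_coeff c k j) z + (if j = 0 then 0 else leibniz_coeff c k (j - 1) z))"

lemma leibniz_coeff_holomorphic:
  assumes "c holomorphic_on UNIV"
  shows "leibniz_coeff c k j holomorphic_on UNIV"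
proof (induction k arbitrary: j)
  case 0
  show ?case
    using assms by (cases j) auto
next
  case (Suc k)
  show ?case
    using Suc by (cases j) (auto intro!: holomorphic_intros)
qed

lemma leibniz_coeff_zero: "k < j \<Longrightarrow> leibniz_coeff c k j = (\<lambda>z. 0)"
  by (induction k arbitrary: j) simp_all

lemma leibniz_coeff_diag: "leibniz_coeff c k k z = c z"
  by (induction k) (simp_all add: leibniz_coeff_zero)

text \<open>Each further differentiation adds one copy of \<open>deriv c\<close>, coming from the
  diagonal coefficient \<open>c\<close>. The diagonal fixes how \<open>v n\<close> transforms under
  a translation, and the subdiagonal how \<open>b n\<close> does.\<close>

lemma leibniz_coeff_subdiag: "leibniz_coeff c (Suc k) k z = of_nat (Suc k) * deriv c z"
proof (induction k)
  case 0
  show ?case by simp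
next
  case (Suc k)
  have "leibniz_coeff c (Suc k) (Suc k) = c"
    by (rule ext) (rule leibniz_coeff_diag)
  then show ?case
    using Suc by (subst leibniz_coeff.simps) (simp add: algebra_simps del: leibniz_coeff.simps)
qed

section \<open>The orthogonalised derivatives and their ladder relations\<close>

locale holomorphic_frame =
  fixes f :: "complex \<Rightarrow> 'h::chilbert"
  assumes holo: "cholomorphic f"
    and indep: "\<And>z n. derivs_indep f z n"
begin

abbreviation W :: "nat \<Rightarrow> complex \<Rightarrow> 'h set" where
  "W n z \<equiv> seq_span (\<lambda>k. cderivs k f z) n"

definition v :: "nat \<Rightarrow> complex \<Rightarrow> 'h" where
  "v n z = gram_schmidt (\<lambda>k. cderivs k f z) n"

lemma v_nonzero [simp]: "v n z \<noteq> 0"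
  unfolding v_def by (rule gram_schmidt_nonzero[OF indep])

lemma cinner_v_nonzero [simp]: "cinner (v n z) (v n z) \<noteq> 0"
  by (simp add: cinner_eq_zero_iff)

lemma v_in_W: "k < n \<Longrightarrow> v k z \<in> W n z"
  unfolding v_def using seq_span_mono[OF _ gram_schmidt_in_span, of k n] by simp

lemma v_orthogonal: "j \<noteq> k \<Longrightarrow> cinner (v j z) (v k z) = 0"
  unfolding v_def by (rule gram_schmidt_orthogonal)

lemma W_orthogonal_v: "k \<le> n \<Longrightarrow> x \<in> W k z \<Longrightarrow> cinner x (v n z) = 0"
  unfolding v_def by (rule seq_span_orthogonal_gram_schmidt[OF seq_span_mono])

lemma v_orthogonal_W: "k \<le> n \<Longrightarrow> x \<in> W k z \<Longrightarrow> cinner (v n z) x = 0"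
  using W_orthogonal_v cinner_commute_zero by blast

lemma v_expansion: "x \<in> W n z \<Longrightarrow> x = (\<Sum>k<n. (cinner (v k z) x / cinner (v k z) (v k z)) *\<^sub>C v k z)"
  unfolding v_def by (rule gram_schmidt_expansion) (use v_nonzero in \<open>auto simp: v_def\<close>)

lemma v_eq: "v n z = cderivs n f z
    - (\<Sum>k<n. (cinner (v k z) (cderivs n f z) / cinner (v k z) (v k z)) *\<^sub>C v k z)"
  unfolding v_def by (rule gram_schmidt.simps)

lemma diff_v_in_W: "cderivs n f z - v n z \<in> W n z"
  unfolding v_def by (rule diff_gram_schmidt_in_span)

lemma cinner_v_cderivs: "cinner (v n z) (cderivs n f z) = cinner (v n z) (v n z)"
  unfolding v_def by (rule cinner_gram_schmidt_self)

lemma landau_eq: "landau f n z = complex_of_real (inverse (norm (v n z))) *\<^sub>C v n z"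
  unfolding landau_def rn_def Pn_def orth_proj_gram_schmidt[of "\<lambda>k. cderivs k f z" n] v_def by simp

text \<open>Filtration form of the ladder relations: differentiation in z raises the order by one
  with leading coefficient 1, while dbar falls back into the span of the derivatives of order below
  \<open>n\<close>.\<close>

definition graded_derivs :: "nat \<Rightarrow> (complex \<Rightarrow> 'h) \<Rightarrow> (complex \<Rightarrow> 'h) \<Rightarrow> bool" where
  "graded_derivs n p q \<longleftrightarrow> has_wirtinger (v n) p q
     \<and> (\<forall>z. p z - cderivs (Suc n) f z \<in> W (Suc n) z) \<and> (\<forall>z. q z \<in> W n z)"

text \<open>In \<open>v n\<close>, the leading term \<open>cderivs n f\<close> is holomorphic, so
  its dbar-derivative is 0. All other terms are multiples of \<open>v k\<close> with
  \<open>k < n\<close>, whose derivatives have low enough order by induction.\<close>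

lemma ex_graded_derivs: "\<exists>p q. graded_derivs n p q"
proof (induction n rule: less_induct)
  case (less n)
  define P where "P k = (SOME p. \<exists>q. graded_derivs k p q)" for k
  define Q where "Q k = (SOME q. graded_derivs k (P k) q)" for k
  have PQ: "graded_derivs k (P k) (Q k)" if "k < n" for k
    unfolding Q_def P_def by (rule someI_ex[OF someI_ex[OF less[OF that]]])
  have v: "has_wirtinger (v k) (P k) (Q k)" if "k < n" for k
    using PQ[OF that] by (simp add: graded_derivs_def)
  have P: "P k z - cderivs (Suc k) f z \<in> W (Suc k) z" and Q: "Q k z \<in> W k z" if "k < n" for k z
    using PQ[OF that] by (simp_all add: graded_derivs_def)
  define c where "c k z = cinner (v k z) (cderivs n f z) / cinner (v k z) (v k z)" for k z
  have "\<exists>rs. has_wirtinger (c k) (fst rs) (snd rs)" if "k < n" for k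
    unfolding c_def[abs_def]
    using has_wirtinger_divide[OF has_wirtinger_cinner[OF v[OF that] has_wirtinger_cderivs[OF holo]]
        has_wirtinger_cinner[OF v[OF that] v[OF that]] cinner_v_nonzero] by fastforce
  \<comment> \<open>Any values of the derivatives of the coefficients will do: they only multiply
    \<open>v k\<close> with \<open>k < n\<close>, which already lies in \<open>W n\<close>.\<close>
  then have "\<forall>k. \<exists>rs. k < n \<longrightarrow> has_wirtinger (c k) (fst rs) (snd rs)"
    by blast
  then obtain rs where rs: "\<And>k. k < n \<Longrightarrow> has_wirtinger (c k) (fst (rs k)) (snd (rs k))"
    using choice[of "\<lambda>k rs. k < n \<longrightarrow> has_wirtinger (c k) (fst rs) (snd rs)"] by blast
  define r s where "r k = fst (rs k)" and "s k = snd (rs k)" for k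
  have c: "has_wirtinger (c k) (r k) (s k)" if "k < n" for k
    unfolding r_def s_def by (rule rs[OF that])
  have eq: "v n = (\<lambda>z. cderivs n f z - (\<Sum>k<n. c k z *\<^sub>C v k z))"
    unfolding c_def by (rule ext) (rule v_eq)
  have wn: "has_wirtinger (v n)
      (\<lambda>z. cderivs (Suc n) f z - (\<Sum>k<n. r k z *\<^sub>C v k z + c k z *\<^sub>C P k z))
      (\<lambda>z. 0 - (\<Sum>k<n. s k z *\<^sub>C v k z + c k z *\<^sub>C Q k z))"
    by (subst eq, rule has_wirtinger_diff[OF has_wirtinger_cderivs[OF holo]],
        rule has_wirtinger_sum, rule has_wirtinger_scaleC) (auto intro: c v)
  have Pn: "P k z \<in> W (Suc n) z" if "k < n" for k z
  proof -
    have "P k z - cderivs (Suc k) f z \<in> W (Suc n) z"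
      using that by (intro seq_span_mono[OF _ P[OF that]]) simp
    moreover have "cderivs (Suc k) f z \<in> W (Suc n) z"
      using that by (intro seq_span_base[of "Suc k" "Suc n" "\<lambda>k. cderivs k f z"]) simp
    ultimately show ?thesis
      using cv.span_add by fastforce
  qed
  have Qn: "Q k z \<in> W n z" if "k < n" for k z
    using that by (intro seq_span_mono[OF _ Q[OF that]]) simp
  show ?case
    unfolding graded_derivs_def
  proof (intro exI conjI allI)
    fix z
    have "- (\<Sum>k<n. r k z *\<^sub>C v k z + c k z *\<^sub>C P k z) \<in> W (Suc n) z"
      by (intro cv.span_neg cv.span_sum cv.span_add cv.span_scale v_in_W Pn) auto
    then show "cderivs (Suc n) f z - (\<Sum>k<n. r k z *\<^sub>C v k z + c k z *\<^sub>C P k z) - cderivs (Suc n) f z \<in> W (Suc n) z"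
      by simp
    show "0 - (\<Sum>k<n. s k z *\<^sub>C v k z + c k z *\<^sub>C Q k z) \<in> W n z"
      by (intro cv.span_diff cv.span_zero cv.span_sum cv.span_add cv.span_scale v_in_W Qn) auto
  qed (rule wn)
qed

text \<open>The convention \<open>rho 0 = 0\<close> makes the lowering relation below hold for \<open>n = 0\<close> too, where
  \<open>v (n - 1)\<close> is the junk value \<open>v 0\<close>.\<close>

primrec rho :: "nat \<Rightarrow> complex \<Rightarrow> real" where
  "rho 0 = (\<lambda>z. 0)"
| "rho (Suc n) = (\<lambda>z. (norm (v (Suc n) z))\<^sup>2 / (norm (v n z))\<^sup>2)"

lemma rho_Suc_cinner:
  "complex_of_real (rho (Suc n) z) = cinner (v (Suc n) z) (v (Suc n) z) / cinner (v n z) (v n z)"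
  by (simp add: cinner_self)

text \<open>Differentiating the orthogonality of \<open>v k\<close> and \<open>v n\<close> removes
  all but the neighbouring components that the filtration leaves open. The factor
  \<open>\<alpha>\<close> can stay existential because it only affects the component along
  \<open>v n\<close>, which later cancels.\<close>

lemma v_ladder:
  "\<exists>\<alpha>. has_wirtinger (v n) (\<lambda>z. v (Suc n) z + \<alpha> z *\<^sub>C v n z) (\<lambda>z. - (complex_of_real (rho n z) *\<^sub>C v (n - 1) z))"
proof -
  define P where "P k = (SOME p. \<exists>q. graded_derivs k p q)" for k
  define Q where "Q k = (SOME q. graded_derivs k (P k) q)" for k
  have PQ: "graded_derivs k (P k) (Q k)" for k
    unfolding Q_def P_def by (rule someI_ex[OF someI_ex[OF ex_graded_derivs]])
  have v: "has_wirtinger (v k) (P k) (Q k)" for k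
    using PQ by (simp add: graded_derivs_def)
  have P: "P k z - cderivs (Suc k) f z \<in> W (Suc k) z" and Q: "Q k z \<in> W k z" for k z
    using PQ by (simp_all add: graded_derivs_def)
  have orth: "cinner (Q k z) (v n z) + cinner (v k z) (P n z) = 0 \<and>
      cinner (P k z) (v n z) + cinner (v k z) (Q n z) = 0" if "k \<noteq> n" for k n z
  proof -
    have "has_wirtinger (\<lambda>z. cinner (v k z) (v n z)) (\<lambda>z. 0) (\<lambda>z. 0)"
      by (simp add: v_orthogonal[OF that] has_wirtinger_const)
    from has_wirtinger_unique[OF has_wirtinger_cinner[OF v[of k] v[of n]] this] show ?thesis
      by (simp add: fun_eq_iff)
  qed
  \<comment> \<open>The dbar-derivative of \<open>v k\<close> lies in \<open>W k\<close> and is thus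
    orthogonal to \<open>v n\<close>; hence the z-derivative of \<open>v n\<close> has no component
    along \<open>v k\<close>.\<close>
  have vP: "cinner (v k z) (P n z) = 0" if "k < n" for k n z
    using orth[of k n z] that W_orthogonal_v[OF _ Q, of k n z] by simp
  define \<alpha> where "\<alpha> n z = cinner (v n z) (P n z - v (Suc n) z) / cinner (v n z) (v n z)" for n z
  have P_eq: "P n z = v (Suc n) z + \<alpha> n z *\<^sub>C v n z" for n z
  proof -
    define x where "x = P n z - v (Suc n) z"
    have "x = (P n z - cderivs (Suc n) f z) + (cderivs (Suc n) f z - v (Suc n) z)"
      by (simp add: x_def)
    then have "x \<in> W (Suc n) z"
      using cv.span_add[OF P diff_v_in_W] by metis
    then have "x = (\<Sum>k<Suc n. (cinner (v k z) x / cinner (v k z) (v k z)) *\<^sub>C v k z)"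
      by (rule v_expansion)
    moreover have "cinner (v k z) x = 0" if "k < n" for k
      using that vP[OF that] v_orthogonal[of k "Suc n"] by (simp add: x_def cinner_diff_right)
    ultimately have "x = \<alpha> n z *\<^sub>C v n z"
      by (simp add: \<alpha>_def x_def)
    then show ?thesis
      by (simp add: x_def algebra_simps)
  qed
  \<comment> \<open>By \<open>P_eq\<close>, the z-derivative of \<open>v k\<close> involves only
    \<open>v (Suc k)\<close> and \<open>v k\<close>, so its product with \<open>v n\<close> survives
    for \<open>Suc k = n\<close> only. Dividing by the squared norm of \<open>v k\<close> will give
    \<open>- rho n\<close>.\<close>
  have vQ: "cinner (v k z) (Q n z) = (if Suc k = n then - cinner (v n z) (v n z) else 0)" if "k < n" for k
    and z
  proof -
    have "cinner (v k z) (Q n z) = - cinner (P k z) (v n z)"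
      using orth[of k n z] that by (simp add: eq_neg_iff_add_eq_0 add.commute)
    then show ?thesis
      using that v_orthogonal[of k n z] v_orthogonal[of "Suc k" n z]
      by (auto simp: P_eq cinner_add_left cinner_scaleC_left)
  qed
  have Q_eq: "Q n z = - (complex_of_real (rho n z) *\<^sub>C v (n - 1) z)" for z
  proof (cases n)
    case 0
    then show ?thesis
      using Q[of 0 z] by simp
  next
    case (Suc m)
    have "Q n z = (\<Sum>k<n. (cinner (v k z) (Q n z) / cinner (v k z) (v k z)) *\<^sub>C v k z)"
      using Q by (rule v_expansion)
    also have "\<dots> = (cinner (v m z) (Q n z) / cinner (v m z) (v m z)) *\<^sub>C v m z"
      using vQ Suc by simp
    also have "\<dots> = - (complex_of_real (rho n z) *\<^sub>C v (n - 1) z)"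
      using vQ[of m z] Suc by (simp only: rho_Suc_cinner) simp
    finally show ?thesis .
  qed
  have "P n = (\<lambda>z. v (Suc n) z + \<alpha> n z *\<^sub>C v n z)" "Q n = (\<lambda>z. - (complex_of_real (rho n z) *\<^sub>C v (n - 1) z))"
    using P_eq Q_eq by auto
  then show ?thesis
    using v[of n] by auto
qed

lemma v_continuous: "continuous_on UNIV (v n)"
  using v_ladder[of n] has_wirtinger_continuous by blast

lemma rho_continuous: "continuous_on UNIV (rho n)"
  by (cases n) (auto intro!: continuous_intros v_continuous)

text \<open>Up to sign, \<open>b n\<close> is the coefficient of the \<open>n\<close>-th derivative of \<open>f\<close> in \<open>v (Suc n)\<close>.\<close>

definition b :: "nat \<Rightarrow> complex \<Rightarrow> complex" where
  "b n z = cinner (v n z) (cderivs (Suc n) f z) / cinner (v n z) (v n z)"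

text \<open>By the quotient rule, the conjugate of \<open>\<alpha>\<close> enters through both
  numerator and denominator and cancels. What remains is
  \<open>cinner (v (Suc n) z) (cderivs (Suc n) f z)\<close>, the squared norm of
  \<open>v (Suc n)\<close>, over that of \<open>v n\<close>.\<close>

lemma b_has_wirtinger: "\<exists>p. has_wirtinger (b n) p (\<lambda>z. complex_of_real (rho (Suc n) z))"
proof -
  obtain \<alpha> where v: "has_wirtinger (v n) (\<lambda>z. v (Suc n) z + \<alpha> z *\<^sub>C v n z)
      (\<lambda>z. - (complex_of_real (rho n z) *\<^sub>C v (n - 1) z))"
    using v_ladder by blast
  \<comment> \<open>For \<open>n = 0\<close> the inner product itself is nonzero, as
    \<open>v (n - 1)\<close> is then \<open>v n\<close>; the factor \<open>rho 0 = 0\<close> makes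
    the product vanish.\<close>
  have lower: "complex_of_real (rho n z) * cinner (v n z) (v (n - 1) z) = 0" for z
    by (cases n) (simp_all add: v_orthogonal)
  note D = has_wirtinger_divide[OF has_wirtinger_cinner[OF v has_wirtinger_cderivs[OF holo, of "Suc n"]]
      has_wirtinger_cinner[OF v v] cinner_v_nonzero]
  have "((cinner (v (Suc n) z + \<alpha> z *\<^sub>C v n z) (cderivs (Suc n) f z) + cinner (v n z) 0) * cinner (v n z) (v n z)
      - cinner (v n z) (cderivs (Suc n) f z)
        * (cinner (v (Suc n) z + \<alpha> z *\<^sub>C v n z) (v n z)
           + cinner (v n z) (- (complex_of_real (rho n z) *\<^sub>C v (n - 1) z)))) / (cinner (v n z) (v n z))\<^sup>2
     = complex_of_real (rho (Suc n) z)" for z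
    unfolding rho_Suc_cinner using lower[of z]
    by (auto simp: cinner_add_left cinner_scaleC_left cinner_minus_right cinner_scaleC_right
        cinner_v_cderivs v_orthogonal power2_eq_square field_simps del: rho.simps)
  with D show ?thesis
    unfolding b_def[abs_def] by (auto simp del: rho.simps)
qed

text \<open>Everything along \<open>v n\<close>, including the derivative of the normalising factor,
  is collected in \<open>\<gamma>\<close>, because the quantum geometric tensor projects this
  direction out.\<close>

lemma landau_has_derivative:
  "\<exists>\<gamma>. (landau f n has_derivative
      (\<lambda>h. \<gamma> h *\<^sub>C v n z + complex_of_real (inverse (norm (v n z))) *\<^sub>C
        (h *\<^sub>C v (Suc n) z - (cnj h * complex_of_real (rho n z)) *\<^sub>C v (n - 1) z))) (at z)"
proof -
  obtain \<alpha> where v: "has_wirtinger (v n) (\<lambda>z. v (Suc n) z + \<alpha> z *\<^sub>C v n z)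
      (\<lambda>z. - (complex_of_real (rho n z) *\<^sub>C v (n - 1) z))"
    using v_ladder by blast
  have vd: "(v n has_derivative (\<lambda>h. h *\<^sub>C (v (Suc n) z + \<alpha> z *\<^sub>C v n z)
      + cnj h *\<^sub>C (- (complex_of_real (rho n z) *\<^sub>C v (n - 1) z)))) (at z)"
    using v by (simp add: has_wirtinger_def)
  obtain N' where "((\<lambda>z. cinner (v n z) (v n z)) has_derivative N') (at z)"
    using has_wirtinger_cinner[OF v v] unfolding has_wirtinger_def by blast
  then have N: "((\<lambda>z. Re (cinner (v n z) (v n z))) has_derivative (\<lambda>h. Re (N' h))) (at z)"
    by (rule bounded_linear.has_derivative[OF bounded_linear_Re])
  have pos: "Re (cinner (v n z) (v n z)) > 0"
    by (simp add: cinner_self)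
  have "((\<lambda>x. inverse (sqrt x)) has_real_derivative
      - (inverse (sqrt (Re (cinner (v n z) (v n z)))) / 2) / (Re (cinner (v n z) (v n z)))) (at (Re (cinner (v n z) (v n z))))"
    using pos by (auto intro!: derivative_eq_intros simp: field_simps power2_eq_square)
  \<comment> \<open>The value of this derivative is forgotten: it contributes to
    \<open>\<gamma>\<close> only.\<close>
  then obtain d where d: "((\<lambda>x. inverse (sqrt x)) has_real_derivative d) (at (Re (cinner (v n z) (v n z))))"
    by blast
  have "((\<lambda>z. complex_of_real (inverse (norm (v n z)))) has_derivative
      (\<lambda>h. complex_of_real (d * Re (N' h)))) (at z)"
    unfolding norm_eq_sqrt_cinner
    by (rule bounded_linear.has_derivative[OF bounded_linear_of_real])
      (use has_derivative_compose[OF N d[unfolded has_field_derivative_def]] in simp)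
  from bounded_bilinear.FDERIV[OF bounded_bilinear_scaleC this vd]
  have L: "((\<lambda>z. complex_of_real (inverse (norm (v n z))) *\<^sub>C v n z) has_derivative
      (\<lambda>h. complex_of_real (inverse (norm (v n z))) *\<^sub>C (h *\<^sub>C (v (Suc n) z + \<alpha> z *\<^sub>C v n z)
        + cnj h *\<^sub>C (- (complex_of_real (rho n z) *\<^sub>C v (n - 1) z)))
        + complex_of_real (d * Re (N' h)) *\<^sub>C v n z)) (at z)" .
  have l: "landau f n = (\<lambda>z. complex_of_real (inverse (norm (v n z))) *\<^sub>C v n z)"
    by (rule ext) (rule landau_eq)
  show ?thesis
    unfolding l
    by (rule exI[of _ "\<lambda>h. complex_of_real (d * Re (N' h)) + complex_of_real (inverse (norm (v n z))) * h * \<alpha> z"],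
        rule has_derivative_eq_rhs[OF L])
      (simp add: fun_eq_iff scaleC_add_right scaleC_add_left scaleC_scaleC cv.scale_right_diff_distrib
        algebra_simps del: rho.simps of_real_mult of_real_inverse)
qed

text \<open>Only the part \<open>y\<close> of the derivative orthogonal to \<open>v n\<close>
  counts. Its raising and lowering components are mutually orthogonal; the raising one is complex
  linear in the direction and the lowering one antilinear, whence the two conjugation
  patterns.\<close>

lemma qgt_landau:
  "qgt (landau f n) a c z = cnj a * c * complex_of_real (rho (Suc n) z) + a * cnj c * complex_of_real (rho n z)"
proof -
  define \<sigma> where "\<sigma> = complex_of_real (inverse (norm (v n z)))"
  define y where "y h = \<sigma> *\<^sub>C (h *\<^sub>C v (Suc n) z - (cnj h * complex_of_real (rho n z)) *\<^sub>C v (n - 1) z)" for h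
  obtain \<gamma> where "(landau f n has_derivative (\<lambda>h. \<gamma> h *\<^sub>C v n z + y h)) (at z)"
    using landau_has_derivative unfolding y_def \<sigma>_def by blast
  then have pd: "pdir (landau f n) h z = \<gamma> h *\<^sub>C v n z + y h" for h
    by (rule pdir_eq)
  have u: "landau f n z = \<sigma> *\<^sub>C v n z"
    unfolding \<sigma>_def by (rule landau_eq)
  have \<sigma>: "cnj \<sigma> = \<sigma>" "\<sigma> * \<sigma> * cinner (v n z) (v n z) = 1"
    by (simp_all add: \<sigma>_def cinner_self power2_eq_square field_simps)
  have lower: "complex_of_real (rho n z) * cinner (v n z) (v (n - 1) z) = 0"
    "complex_of_real (rho n z) * cinner (v (n - 1) z) (v n z) = 0"
    by (cases n; simp add: v_orthogonal)+
  have yv: "cinner (v n z) (y h) = 0" "cinner (y h) (v n z) = 0" for h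
    using lower v_orthogonal[of n "Suc n" z] v_orthogonal[of "Suc n" n z]
    by (auto simp: y_def cinner_diff_right cinner_diff_left cinner_scaleC_right cinner_scaleC_left)
  have cross: "cinner (v (Suc n) z) (v (n - 1) z) = 0" "cinner (v (n - 1) z) (v (Suc n) z) = 0"
    by (simp_all add: v_orthogonal)
  have "qgt (landau f n) a c z = cinner (y a) (y c)
      + cnj (\<gamma> a) * \<gamma> c * cinner (v n z) (v n z) * (1 - \<sigma> * \<sigma> * cinner (v n z) (v n z))"
    unfolding qgt_def pd u
    by (simp add: cinner_add_left cinner_add_right cinner_scaleC_left cinner_scaleC_right yv \<sigma>(1) algebra_simps)
  also have "\<dots> = cinner (y a) (y c)"
    by (simp add: \<sigma>)
  also have "\<dots> = \<sigma> * \<sigma> * (cnj a * c * cinner (v (Suc n) z) (v (Suc n) z)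
      + a * cnj c * (complex_of_real (rho n z))\<^sup>2 * cinner (v (n - 1) z) (v (n - 1) z))"
    unfolding y_def using cross
    by (simp add: cinner_diff_right cinner_diff_left cinner_scaleC_right cinner_scaleC_left
        \<sigma>(1) algebra_simps power2_eq_square del: rho.simps)
  also have "\<dots> = cnj a * c * (\<sigma> * \<sigma> * cinner (v (Suc n) z) (v (Suc n) z))
      + a * cnj c * (\<sigma> * \<sigma> * (complex_of_real (rho n z))\<^sup>2 * cinner (v (n - 1) z) (v (n - 1) z))"
    by (simp add: algebra_simps)
  also have "\<sigma> * \<sigma> * cinner (v (Suc n) z) (v (Suc n) z) = complex_of_real (rho (Suc n) z)"
    by (simp add: \<sigma>_def cinner_self field_simps power2_eq_square)
  also have "\<sigma> * \<sigma> * (complex_of_real (rho n z))\<^sup>2 * cinner (v (n - 1) z) (v (n - 1) z) = complex_of_real (rho n z)"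
    by (cases n) (simp_all add: \<sigma>_def cinner_self field_simps power2_eq_square)
  finally show ?thesis .
qed

text \<open>For the directions 1 and \<open>\<i>\<close>, the raising term contributes
  \<open>\<i> * rho (Suc n) z\<close> and the lowering term \<open>- \<i> * rho n z\<close>.\<close>

lemma berry_landau: "berry (landau f n) z = 2 * (rho (Suc n) z - rho n z)"
  by (simp add: berry_def qgt_landau del: rho.simps)

lemma trace_metric_landau: "trace_metric (landau f n) z = 2 * (rho (Suc n) z + rho n z)"
  by (simp add: trace_metric_def qgt_landau del: rho.simps)

section \<open>Behaviour under lattice translations\<close>

context
  fixes l :: complex and c :: "complex \<Rightarrow> complex" and V :: "'h \<Rightarrow> 'h"
  assumes c: "c holomorphic_on UNIV" "\<And>z. c z \<noteq> 0" and V: "unitary_op V"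
    and shift: "\<And>z. f (z + l) = c z *\<^sub>C V (f z)"
begin

text \<open>Leibniz rule for \<open>c\<close> times \<open>f\<close>. Since \<open>V\<close> does
  not depend on z it commutes with differentiation, and uniqueness of derivatives compares the two
  sides.\<close>

lemma cderivs_shift: "cderivs k f (z + l) = V (\<Sum>j\<le>k. leibniz_coeff c k j z *\<^sub>C cderivs j f z)"
proof (induction k arbitrary: z)
  case 0
  show ?case
    using shift by (simp add: cderivs_def unitary_op_scaleC[OF V])
next
  case (Suc k)
  let ?d = "leibniz_coeff c"
  have 1: "has_wirtinger (\<lambda>z. cderivs k f (z + l)) (\<lambda>z. cderivs (Suc k) f (z + l)) (\<lambda>z. 0)"
    by (rule has_wirtinger_shift[OF has_wirtinger_cderivs[OF holo]])
  have "has_wirtinger (\<lambda>z. V (\<Sum>j\<le>k. ?d k j z *\<^sub>C cderivs j f z))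
     (\<lambda>z. V (\<Sum>j\<le>k. deriv (?d k j) z *\<^sub>C cderivs j f z + ?d k j z *\<^sub>C cderivs (Suc j) f z))
     (\<lambda>z. V (\<Sum>j\<le>k. 0 *\<^sub>C cderivs j f z + ?d k j z *\<^sub>C 0))"
    by (intro has_wirtinger_unitary[OF V] has_wirtinger_sum has_wirtinger_scaleC
        has_wirtinger_holomorphic leibniz_coeff_holomorphic c has_wirtinger_cderivs[OF holo])
  then have 2: "has_wirtinger (\<lambda>z. cderivs k f (z + l))
     (\<lambda>z. V (\<Sum>j\<le>k. deriv (?d k j) z *\<^sub>C cderivs j f z + ?d k j z *\<^sub>C cderivs (Suc j) f z))
     (\<lambda>z. V (\<Sum>j\<le>k. 0 *\<^sub>C cderivs j f z + ?d k j z *\<^sub>C 0))"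
    by (simp only: Suc)
  have "cderivs (Suc k) f (z + l)
      = V (\<Sum>j\<le>k. deriv (?d k j) z *\<^sub>C cderivs j f z + ?d k j z *\<^sub>C cderivs (Suc j) f z)"
    using has_wirtinger_unique[OF 1 2] by (auto dest: fun_cong)
  also have "(\<Sum>j\<le>k. deriv (?d k j) z *\<^sub>C cderivs j f z + ?d k j z *\<^sub>C cderivs (Suc j) f z)
      = (\<Sum>j\<le>Suc k. ?d (Suc k) j z *\<^sub>C cderivs j f z)"
  proof -
    have "(\<Sum>j\<le>Suc k. ?d (Suc k) j z *\<^sub>C cderivs j f z)
        = (\<Sum>j\<le>Suc k. deriv (?d k j) z *\<^sub>C cderivs j f z)
          + (\<Sum>j\<le>Suc k. (if j = 0 then 0 else ?d k (j - 1) z) *\<^sub>C cderivs j f z)"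
      by (simp only: leibniz_coeff.simps scaleC_add_left sum.distrib)
    also have "(\<Sum>j\<le>Suc k. deriv (?d k j) z *\<^sub>C cderivs j f z) = (\<Sum>j\<le>k. deriv (?d k j) z *\<^sub>C cderivs j f z)"
      by (simp add: leibniz_coeff_zero)
    also have "(\<Sum>j\<le>Suc k. (if j = 0 then 0 else ?d k (j - 1) z) *\<^sub>C cderivs j f z)
        = (\<Sum>j\<le>k. ?d k j z *\<^sub>C cderivs (Suc j) f z)"
      by (subst sum.atMost_Suc_shift) simp
    finally show ?thesis
      by (simp add: sum.distrib)
  qed
  finally show ?case .
qed

lemma leibniz_tail_in_W: "(\<Sum>j<k. a j *\<^sub>C cderivs j f z) \<in> W k z"
  by (intro cv.span_sum cv.span_scale seq_span_base[of _ _ "\<lambda>k. cderivs k f z"]) simp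

text \<open>The translated n-th derivative is \<open>V\<close> applied to \<open>c z\<close> times
  the old one plus a vector \<open>w\<close> in \<open>W n\<close>. Orthogonalisation removes
  \<open>w\<close>, and \<open>V\<close> preserves all inner products.\<close>

lemma v_shift: "v n (z + l) = c z *\<^sub>C V (v n z)"
proof (induction n rule: less_induct)
  case (less n)
  define w where "w = (\<Sum>j<n. leibniz_coeff c n j z *\<^sub>C cderivs j f z)"
  define X where "X = c z *\<^sub>C cderivs n f z + w"
  have w: "w \<in> W n z"
    unfolding w_def by (rule leibniz_tail_in_W)
  have e: "cderivs n f (z + l) = V X"
    unfolding cderivs_shift X_def w_def
    by (simp add: lessThan_Suc_atMost[symmetric] leibniz_coeff_diag add.commute)
  have "v n (z + l) = V X - (\<Sum>k<n. (cinner (v k (z + l)) (V X) / cinner (v k (z + l)) (v k (z + l))) *\<^sub>C v k (z + l))"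
    by (subst v_eq) (simp only: e)
  also have "(\<Sum>k<n. (cinner (v k (z + l)) (V X) / cinner (v k (z + l)) (v k (z + l))) *\<^sub>C v k (z + l))
      = (\<Sum>k<n. (cinner (v k z) X / cinner (v k z) (v k z)) *\<^sub>C V (v k z))"
    using c(2)[of z]
    by (intro sum.cong refl)
      (simp add: less cinner_scaleC_left cinner_scaleC_right unitary_op_cinner[OF V] scaleC_scaleC)
  also have "\<dots> = V (\<Sum>k<n. (cinner (v k z) X / cinner (v k z) (v k z)) *\<^sub>C v k z)"
    by (simp add: unitary_op_sum[OF V] unitary_op_scaleC[OF V])
  also have "(\<Sum>k<n. (cinner (v k z) X / cinner (v k z) (v k z)) *\<^sub>C v k z)
      = c z *\<^sub>C (\<Sum>k<n. (cinner (v k z) (cderivs n f z) / cinner (v k z) (v k z)) *\<^sub>C v k z)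
       + (\<Sum>k<n. (cinner (v k z) w / cinner (v k z) (v k z)) *\<^sub>C v k z)"
    by (simp add: X_def cinner_add_right cinner_scaleC_right add_divide_distrib scaleC_add_left
        sum.distrib cv.scale_sum_right scaleC_scaleC)
  \<comment> \<open>The first sum is the projection of the n-th derivative, the second the
    projection of \<open>w\<close>, which is \<open>w\<close> itself.\<close>
  also have "\<dots> = c z *\<^sub>C (cderivs n f z - v n z) + w"
    using v_eq[of n z] v_expansion[OF w] by (metis (no_types, lifting) add_diff_cancel_left' diff_add_cancel)
  also have "V X - V (c z *\<^sub>C (cderivs n f z - v n z) + w) = V (X - (c z *\<^sub>C (cderivs n f z - v n z) + w))"
    by (simp add: unitary_op_diff[OF V])
  also have "X - (c z *\<^sub>C (cderivs n f z - v n z) + w) = c z *\<^sub>C v n z"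
    by (simp add: X_def cv.scale_right_diff_distrib)
  finally show ?case
    by (simp add: unitary_op_scaleC[OF V])
qed

lemma rho_shift: "rho n (z + l) = rho n z"
proof (cases n)
  case (Suc m)
  have "norm (v k (z + l)) = cmod (c z) * norm (v k z)" for k
    by (simp add: v_shift norm_scaleC unitary_op_norm[OF V])
  then show ?thesis
    using c(2)[of z] Suc by (simp add: power_mult_distrib)
qed simp

text \<open>Derivatives of order below \<open>n\<close> are orthogonal to \<open>v n\<close>, so
  only the two top Leibniz coefficients survive: the diagonal one reproduces \<open>b n\<close> and
  the subdiagonal one gives the additive term.\<close>

lemma b_shift: "b n (z + l) = b n z + of_nat (Suc n) * (deriv c z / c z)"
proof -
  define w where "w = (\<Sum>j<n. leibniz_coeff c (Suc n) j z *\<^sub>C cderivs j f z)"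
  have w: "cinner (v n z) w = 0"
    unfolding w_def by (rule v_orthogonal_W[OF order_refl leibniz_tail_in_W])
  have "cderivs (Suc n) f (z + l)
      = V (w + (of_nat (Suc n) * deriv c z) *\<^sub>C cderivs n f z + c z *\<^sub>C cderivs (Suc n) f z)"
    unfolding cderivs_shift w_def
    by (simp add: lessThan_Suc_atMost[symmetric] leibniz_coeff_diag leibniz_coeff_subdiag del: leibniz_coeff.simps of_nat_Suc)
  then have "b n (z + l) = (of_nat (Suc n) * deriv c z * cinner (v n z) (v n z)
      + c z * cinner (v n z) (cderivs (Suc n) f z)) / (c z * cinner (v n z) (v n z))"
    using c(2)[of z]
    by (simp add: b_def v_shift cinner_scaleC_left cinner_scaleC_right unitary_op_cinner[OF V]
        cinner_add_right w cinner_v_cderivs del: of_nat_Suc)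
  then show ?thesis
    using c(2)[of z] by (simp add: b_def add_divide_distrib del: of_nat_Suc)
qed

end

end

text \<open>The derivative of \<open>Re B\<close> in direction 1 is \<open>Re p + q\<close>, that of
  \<open>Im B\<close> in direction \<open>\<i>\<close> is \<open>Re p - q\<close>. Both integrate to
  zero, and so does their difference \<open>2 * q\<close>.\<close>

lemma integral_fundamental_domain_dbar:
  fixes B :: "complex \<Rightarrow> complex" and q :: "complex \<Rightarrow> real"
  assumes lat: "Im (cnj w1 * w2) \<noteq> 0" and D: "fundamental_domain (lattice w1 w2) D"
    and B: "has_wirtinger B p (\<lambda>z. complex_of_real (q z))"
    and per: "\<And>l z. l \<in> lattice w1 w2 \<Longrightarrow> B (z + l) = B z"
  shows "(LINT z:D|lebesgue. q z) = 0"
proof -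
  let ?B' = "\<lambda>z h. h *\<^sub>C p z + cnj h *\<^sub>C complex_of_real (q z)"
  have der: "(B has_derivative ?B' z) (at z)" for z
    using B by (simp add: has_wirtinger_def)
  have p: "continuous_on UNIV p" and q': "continuous_on UNIV (\<lambda>z. complex_of_real (q z))"
    using B by (simp_all add: has_wirtinger_def)
  have q: "continuous_on UNIV q"
    using continuous_on_Re[OF q'] by simp
  have 1: "(LINT z:D|lebesgue. Re (p z) + q z) = 0"
    using integral_fundamental_domain_directional_derivative[OF lat D
        bounded_linear.has_derivative[OF bounded_linear_Re der], of 1] p q per
    by (simp add: scaleC_complex_def continuous_intros)
  have 2: "(LINT z:D|lebesgue. Re (p z) - q z) = 0"
    using integral_fundamental_domain_directional_derivative[OF lat D
        bounded_linear.has_derivative[OF bounded_linear_Im der], of \<i>] p q per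
    by (simp add: scaleC_complex_def continuous_intros)
  \<comment> \<open>Splitting the integral requires both parts to be integrable, for which
    \<open>p\<close> and \<open>q\<close> must be periodic; uniqueness of derivatives transfers this
    from \<open>B\<close>.\<close>
  have pq: "p (z + l) = p z \<and> q (z + l) = q z" if "l \<in> lattice w1 w2" for z l
  proof -
    have "(\<lambda>z. B (z + l)) = B"
      using per[OF that] by auto
    then have "has_wirtinger B (\<lambda>z. p (z + l)) (\<lambda>z. complex_of_real (q (z + l)))"
      using has_wirtinger_shift[OF B, of l] by simp
    from has_wirtinger_unique[OF this B] show ?thesis
      by (simp add: fun_eq_iff)
  qed
  have "(LINT z:D|lebesgue. 2 * q z) = (LINT z:D|lebesgue. (Re (p z) + q z) - (Re (p z) - q z))"
    by simp
  also have "\<dots> = (LINT z:D|lebesgue. Re (p z) + q z) - (LINT z:D|lebesgue. Re (p z) - q z)"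
    by (intro set_integral_diff periodic_set_integrable[OF lat D] continuous_intros p q)
      (simp_all add: pq)
  finally show ?thesis
    by (simp add: 1 2)
qed

theorem theorem1:
  fixes f :: "complex \<Rightarrow> 'h::chilbert" and w1 w2 :: complex and D :: "complex set"
  assumes separable: "\<exists>S::'h set. countable S \<and> closure S = UNIV"
    and lattice_basis: "Im (cnj w1 * w2) \<noteq> 0"
    and fund: "fundamental_domain (lattice w1 w2) D"
    and holo: "cholomorphic f"
    and indep: "\<And>z n. derivs_indep f z n"
    and quasi_periodic: "\<And>l. l \<in> lattice w1 w2 \<Longrightarrow>
        \<exists>c V. c holomorphic_on UNIV \<and> (\<forall>z. c z \<noteq> 0) \<and> unitary_op V
              \<and> (\<forall>z. f (z + l) = c z *\<^sub>C V (f z))"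
  shows "integral D (berry (landau f n)) / (2 * pi) = chern f D
       \<and> integral D (trace_metric (landau f n)) / (2 * pi)
           = (2 * real n + 1) * (integral D (berry (landau f n)) / (2 * pi))
       \<and> (2 * real n + 1) * (integral D (berry (landau f n)) / (2 * pi))
           = (2 * real n + 1) * chern f D"
proof -
  interpret holomorphic_frame f
    by unfold_locales (use holo indep in auto)
  have rho_per: "rho n (z + l) = rho n z" if "l \<in> lattice w1 w2" for n l z
    using quasi_periodic[OF that] rho_shift by blast
  have rho_int: "set_integrable lebesgue D (rho n)" for n
    by (rule periodic_set_integrable[OF lattice_basis fund rho_continuous rho_per])
  define I where "I n = (LINT z:D|lebesgue. rho n z)" for n
  have I_Suc: "I (Suc n) = real (Suc n) * I 1" for n
  proof -
    define B where "B z = b n z - of_nat (Suc n) *\<^sub>C b 0 z" for z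
    obtain p p0 where p: "has_wirtinger (b n) p (\<lambda>z. complex_of_real (rho (Suc n) z))"
      and p0: "has_wirtinger (b 0) p0 (\<lambda>z. complex_of_real (rho (Suc 0) z))"
      using b_has_wirtinger by blast
    have "has_wirtinger B (\<lambda>z. p z - of_nat (Suc n) * p0 z)
        (\<lambda>z. complex_of_real (rho (Suc n) z - real (Suc n) * rho (Suc 0) z))"
      using has_wirtinger_diff[OF p has_wirtinger_scaleC[OF has_wirtinger_const p0], of "of_nat (Suc n)"]
      unfolding B_def[abs_def] by (simp add: scaleC_complex_def del: rho.simps)
    moreover have "B (z + l) = B z" if l: "l \<in> lattice w1 w2" for l z
    proof -
      obtain c V where "c holomorphic_on UNIV" "\<And>z. c z \<noteq> 0" "unitary_op V"
          "\<And>z. f (z + l) = c z *\<^sub>C V (f z)"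
        using quasi_periodic[OF l] by blast
      then have "b m (z + l) = b m z + of_nat (Suc m) * (deriv c z / c z)" for m
        by (rule b_shift)
      then show ?thesis
        by (simp add: B_def scaleC_complex_def algebra_simps)
    qed
    ultimately have "(LINT z:D|lebesgue. rho (Suc n) z - real (Suc n) * rho (Suc 0) z) = 0"
      by (rule integral_fundamental_domain_dbar[OF lattice_basis fund])
    then show ?thesis
      using rho_int[of "Suc n"] rho_int[of "Suc 0"] by (simp add: I_def set_integral_diff del: rho.simps)
  qed
  have I: "I n = real n * I 1" for n
  proof (cases n)
    case 0
    then show ?thesis by (simp add: I_def)
  next
    case (Suc m)
    then show ?thesis by (simp only: I_Suc)
  qed
  \<comment> \<open>\<open>I\<close> is linear in its index, so \<open>I (Suc n) - I n\<close> is
    \<open>I 1\<close> for every \<open>n\<close>; the case \<open>n = 0\<close> is the Chern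
    number.\<close>
  have berry: "integral D (berry (landau f n)) = 2 * I 1" for n
  proof -
    have "integral D (berry (landau f n)) = integral D (\<lambda>z. 2 * (rho (Suc n) z - rho n z))"
      using berry_landau by presburger
    also have "\<dots> = (LINT z:D|lebesgue. 2 * (rho (Suc n) z - rho n z))"
      \<comment> \<open>The statement uses the gauge integral; absolute integrability identifies it
        with the Lebesgue integral.\<close>
      by (intro set_lebesgue_integral_eq_integral(2)[symmetric] set_integrable_mult_right set_integral_diff(1) rho_int)
    also have "\<dots> = 2 * (I (Suc n) - I n)"
      using rho_int[of "Suc n"] rho_int[of n] by (simp add: I_def set_integral_diff del: rho.simps)
    finally show ?thesis
      using I[of "Suc n"] I[of n] by (simp add: algebra_simps)
  qed
  have "integral D (trace_metric (landau f n)) = integral D (\<lambda>z. 2 * (rho (Suc n) z + rho n z))"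
    using trace_metric_landau by presburger
  also have "\<dots> = (LINT z:D|lebesgue. 2 * (rho (Suc n) z + rho n z))"
    by (intro set_lebesgue_integral_eq_integral(2)[symmetric] set_integrable_mult_right set_integral_add(1) rho_int)
  also have "\<dots> = 2 * (I (Suc n) + I n)"
    using rho_int[of "Suc n"] rho_int[of n] by (simp add: I_def set_integral_add del: rho.simps)
  \<comment> \<open>The factor \<open>2 * real n + 1\<close> is the sum of the indices
    \<open>Suc n\<close> and \<open>n\<close>.\<close>
  finally have "integral D (trace_metric (landau f n)) = (2 * real n + 1) * (2 * I 1)"
    using I[of "Suc n"] I[of n] by (simp add: algebra_simps)
  then show ?thesis
    by (simp add: chern_def berry)
qed

end
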